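(* Let $\{\Delta_n\}_{n\ge 0}$ be a bounded sequence of complex numbers, let $i$ be a nonnegative integer, and let $x,\rho\in\mathbb{C}$, where in each identity below $\rho$ is such that no Pochhammer symbol occurring in a denominator on the left-hand side vanishes; that is, $\rho\notin\{0,-1,-2,\dots\}$ and, in addition, $\rho+i$ in (1), $\rho-i$ in (2), $2-\rho+i$ in (3), $2-\rho-i$ in (4) does not belong to $\{0,-1,-2,\dots\}$. Then the following four identities hold (with the conventions on Gamma factors stated in the context). (1) $$\sum_{m=0}^{\infty}\sum_{n=0}^{\infty}(-1)^n\frac{\Delta_{m+n}\,x^{m+n}}{(\rho)_m(\rho+i)_n\,m!\,n!}=\sum_{m=0}^{\infty}\frac{\Delta_m x^m}{(\rho)_m\,m!}\,\frac{2^m\,\Gamma(\frac12)\,\Gamma(\rho+i)\,\Gamma(1-\rho-m-i)}{\Gamma(1-\rho-m)\,\Gamma(\rho+\frac12 i+\frac12 m-\frac12)\,\Gamma(\rho+\frac12 i+\frac12 m)}\left(\sum_{r=0}^{i}(-1)^r\binom{i}{r}\frac{\Gamma(\rho+\frac12 m+\frac12 i+\frac12 r-\frac12)}{\Gamma(\frac12 r-\frac12 i-\frac12 m+\frac12)}\right).$$ (2) $$\sum_{m=0}^{\infty}\sum_{n=0}^{\infty}(-1)^n\frac{\Delta_{m+n}\,x^{m+n}}{(\rho)_m(\rho-i)_n\,m!\,n!}=\sum_{m=0}^{\infty}\frac{\Delta_m x^m}{(\rho)_m\,m!}\,\frac{2^m\,\Gamma(\frac12)\,\Gamma(\rho-i)}{\Gamma(\rho-\frac12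 i+\frac12 m-\frac12)\,\Gamma(\rho-\frac12 i+\frac12 m)}\left(\sum_{r=0}^{i}\binom{i}{r}\frac{\Gamma(\rho+\frac12 m-\frac12 i+\frac12 r-\frac12)}{\Gamma(\frac12 r-\frac12 i-\frac12 m+\frac12)}\right).$$ (3) $$\sum_{m=0}^{\infty}\sum_{n=0}^{\infty}(-1)^n\frac{\Delta_{m+n}\,x^{m+n}}{(\rho)_m(2-\rho+i)_n\,m!\,n!}=\sum_{m=0}^{\infty}\frac{\Delta_m x^m}{(\rho)_m\,m!}\,\frac{2^{\rho-1+m}\,\Gamma(\frac12)\,\Gamma(2-\rho+i)\,\Gamma(-m-i)}{\Gamma(-m)\,\Gamma(\frac12 m-\frac12\rho+\frac12 i+1)\,\Gamma(\frac12 m-\frac12\rho+\frac12 i+\frac32)}\left(\sum_{r=0}^{i}(-1)^r\binom{i}{r}\frac{\Gamma(\frac12 m-\frac12\rho+\frac12 i+\frac12 r+1)}{\Gamma(\frac12 r-\frac12\rho-\frac12 m-\frac12 i+1)}\right).$$ (4) $$\sum_{m=0}^{\infty}\sum_{n=0}^{\infty}(-1)^n\frac{\Delta_{m+n}\,x^{m+n}}{(\rho)_m(2-\rho-i)_n\,m!\,n!}=\sum_{m=0}^{\infty}\frac{\Delta_m x^m}{(\rho)_m\,m!}\,\frac{2^{\rho-1+m}\,\Gamma(\frac12)\,\Gamma(2-\rho-i)}{\Gamma(\frac12 m-\frac12\rho-\frac12 i+1)\,\Gamma(\frac12 m-\frac12\rho-\frac12 i+\frac32)}\left(\sum_{r=0}^{i}\binom{i}{r}\frac{\Gamma(\frac12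 m-\frac12\rho-\frac12 i+\frac12 r+1)}{\Gamma(\frac12 r-\frac12\rho-\frac12 m-\frac12 i+1)}\right).$$
   Context: Here $i$ is an integer parameter, not the imaginary unit. The Pochhammer symbol is $(\alpha)_0=1$, $(\alpha)_n=\alpha(\alpha+1)\cdots(\alpha+n-1)$ for $n\ge1$. $\Gamma$ is the Euler Gamma function, and $1/\Gamma(z)=0$ for $z\in\{0,-1,-2,\dots\}$. Conventions for singular Gamma factors: the ratio $\Gamma(b-i)/\Gamma(b)$ is understood as the rational function $\frac{1}{(b-i)_i}=\frac{1}{(b-1)(b-2)\cdots(b-i)}$ of $b$. In particular $\frac{\Gamma(-m-i)}{\Gamma(-m)}=\frac{(-1)^i\,m!}{(m+i)!}$ and $\frac{\Gamma(1-\rho-m-i)}{\Gamma(1-\rho-m)}=\frac{(-1)^i}{(\rho+m)_i}$. For exceptional values of $\rho$ at which some other Gamma function in a numerator on the right-hand side has a pole, the $m$-th coefficient (the factor multiplying $\Delta_m x^m$) on the right-hand side is understood as its limiting value as the parameter tends to $\rho$. *)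

theory Defs
  imports "HOL-Analysis.Analysis"
begin

definition Gamma_shift_ratio :: "complex \<Rightarrow> nat \<Rightarrow> complex" where
  "Gamma_shift_ratio b i = 1 / pochhammer (b - of_nat i) i"
  (* \<Gamma>(b - i) / \<Gamma>(b), read as the rational function 1 / ((b - 1) (b - 2) ... (b - i)) of b,
     also at those b where both Gamma factors have poles *)

lemma Gamma_shift_ratio_eq_Gamma:
  assumes "b - of_nat i \<notin> \<int>\<^sub>\<le>\<^sub>0"
  shows "Gamma_shift_ratio b i = Gamma (b - of_nat i) / Gamma b"
  using pochhammer_Gamma[OF assms, of i] by (simp add: Gamma_shift_ratio_def)

text \<open>
  The functions \<open>rhs1\<close> to \<open>rhs4\<close> are the factors multiplying $\Delta_m x^m$ on the right-hand
  sides. A Gamma function in a numerator is written \<^const>\<open>Gamma\<close>, one in a denominator is written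
  with the entire function \<^const>\<open>rGamma\<close> $= 1/\Gamma$, which vanishes at $0, -1, -2, \dots$.
  Since \<^const>\<open>Gamma\<close> is set to $0$ at its poles, the values of \<open>rhs1\<close> to \<open>rhs4\<close> carry no meaning
  where a numerator has a pole; this is the case described by \<open>pole1\<close> to \<open>pole4\<close>, which do
  not mention the numerator of \<^const>\<open>Gamma_shift_ratio\<close>.
\<close>

definition rhs1 :: "nat \<Rightarrow> nat \<Rightarrow> complex \<Rightarrow> complex" where
  "rhs1 i m \<rho> =
     1 / (pochhammer \<rho> m * fact m) *
     (2 ^ m * Gamma (1/2) * Gamma (\<rho> + of_nat i) * Gamma_shift_ratio (1 - \<rho> - of_nat m) i *
      rGamma (\<rho> + of_nat i / 2 + of_nat m / 2 - 1/2) *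
      rGamma (\<rho> + of_nat i / 2 + of_nat m / 2)) *
     (\<Sum>r\<le>i. (-1) ^ r * of_nat (i choose r) *
        Gamma (\<rho> + of_nat m / 2 + of_nat i / 2 + of_nat r / 2 - 1/2) *
        rGamma (of_nat r / 2 - of_nat i / 2 - of_nat m / 2 + 1/2))"

definition pole1 :: "nat \<Rightarrow> nat \<Rightarrow> complex \<Rightarrow> bool" where
  "pole1 i m \<rho> \<longleftrightarrow>
     \<rho> + of_nat i \<in> \<int>\<^sub>\<le>\<^sub>0 \<or>
     (\<exists>r\<le>i. \<rho> + of_nat m / 2 + of_nat i / 2 + of_nat r / 2 - 1/2 \<in> \<int>\<^sub>\<le>\<^sub>0)"

definition rhs2 :: "nat \<Rightarrow> nat \<Rightarrow> complex \<Rightarrow> complex" where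
  "rhs2 i m \<rho> =
     1 / (pochhammer \<rho> m * fact m) *
     (2 ^ m * Gamma (1/2) * Gamma (\<rho> - of_nat i) *
      rGamma (\<rho> - of_nat i / 2 + of_nat m / 2 - 1/2) *
      rGamma (\<rho> - of_nat i / 2 + of_nat m / 2)) *
     (\<Sum>r\<le>i. of_nat (i choose r) *
        Gamma (\<rho> + of_nat m / 2 - of_nat i / 2 + of_nat r / 2 - 1/2) *
        rGamma (of_nat r / 2 - of_nat i / 2 - of_nat m / 2 + 1/2))"

definition pole2 :: "nat \<Rightarrow> nat \<Rightarrow> complex \<Rightarrow> bool" where
  "pole2 i m \<rho> \<longleftrightarrow>
     \<rho> - of_nat i \<in> \<int>\<^sub>\<le>\<^sub>0 \<or>
     (\<exists>r\<le>i. \<rho> + of_nat m / 2 - of_nat i / 2 + of_nat r / 2 - 1/2 \<in> \<int>\<^sub>\<le>\<^sub>0)"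

definition rhs3 :: "nat \<Rightarrow> nat \<Rightarrow> complex \<Rightarrow> complex" where
  "rhs3 i m \<rho> =
     1 / (pochhammer \<rho> m * fact m) *
     (2 powr (\<rho> - 1 + of_nat m) * Gamma (1/2) * Gamma (2 - \<rho> + of_nat i) *
      Gamma_shift_ratio (- of_nat m) i *
      rGamma (of_nat m / 2 - \<rho> / 2 + of_nat i / 2 + 1) *
      rGamma (of_nat m / 2 - \<rho> / 2 + of_nat i / 2 + 3/2)) *
     (\<Sum>r\<le>i. (-1) ^ r * of_nat (i choose r) *
        Gamma (of_nat m / 2 - \<rho> / 2 + of_nat i / 2 + of_nat r / 2 + 1) *
        rGamma (of_nat r / 2 - \<rho> / 2 - of_nat m / 2 - of_nat i / 2 + 1))"

definition pole3 :: "nat \<Rightarrow> nat \<Rightarrow> complex \<Rightarrow> bool" where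
  "pole3 i m \<rho> \<longleftrightarrow>
     2 - \<rho> + of_nat i \<in> \<int>\<^sub>\<le>\<^sub>0 \<or>
     (\<exists>r\<le>i. of_nat m / 2 - \<rho> / 2 + of_nat i / 2 + of_nat r / 2 + 1 \<in> \<int>\<^sub>\<le>\<^sub>0)"

definition rhs4 :: "nat \<Rightarrow> nat \<Rightarrow> complex \<Rightarrow> complex" where
  "rhs4 i m \<rho> =
     1 / (pochhammer \<rho> m * fact m) *
     (2 powr (\<rho> - 1 + of_nat m) * Gamma (1/2) * Gamma (2 - \<rho> - of_nat i) *
      rGamma (of_nat m / 2 - \<rho> / 2 - of_nat i / 2 + 1) *
      rGamma (of_nat m / 2 - \<rho> / 2 - of_nat i / 2 + 3/2)) *
     (\<Sum>r\<le>i. of_nat (i choose r) *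
        Gamma (of_nat m / 2 - \<rho> / 2 - of_nat i / 2 + of_nat r / 2 + 1) *
        rGamma (of_nat r / 2 - \<rho> / 2 - of_nat m / 2 - of_nat i / 2 + 1))"

definition pole4 :: "nat \<Rightarrow> nat \<Rightarrow> complex \<Rightarrow> bool" where
  "pole4 i m \<rho> \<longleftrightarrow>
     2 - \<rho> - of_nat i \<in> \<int>\<^sub>\<le>\<^sub>0 \<or>
     (\<exists>r\<le>i. of_nat m / 2 - \<rho> / 2 - of_nat i / 2 + of_nat r / 2 + 1 \<in> \<int>\<^sub>\<le>\<^sub>0)"

text \<open>
  \<open>limiting_value P F \<rho>\<close> is \<open>F \<rho>\<close>, except that at points \<open>\<rho>\<close> satisfying \<open>P\<close> it is the limit of
  \<open>F \<sigma>\<close> as \<open>\<sigma> \<rightarrow> \<rho>\<close>, \<open>\<sigma> \<noteq> \<rho>\<close>. As \<^const>\<open>Lim\<close> is unspecified for divergent functions, the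
  existence of that limit is stated separately by \<open>has_limiting_value\<close>.
\<close>

definition limiting_value :: "(complex \<Rightarrow> bool) \<Rightarrow> (complex \<Rightarrow> complex) \<Rightarrow> complex \<Rightarrow> complex" where
  "limiting_value P F \<rho> = (if P \<rho> then Lim (at \<rho>) F else F \<rho>)"

definition has_limiting_value :: "(complex \<Rightarrow> bool) \<Rightarrow> (complex \<Rightarrow> complex) \<Rightarrow> complex \<Rightarrow> bool" where
  "has_limiting_value P F \<rho> \<longleftrightarrow> (P \<rho> \<longrightarrow> (\<exists>l. (F \<longlongrightarrow> l) (at \<rho>)))"

definition double_term ::
  "(nat \<Rightarrow> complex) \<Rightarrow> complex \<Rightarrow> complex \<Rightarrow> complex \<Rightarrow> nat \<Rightarrow> nat \<Rightarrow> complex" where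
  "double_term \<Delta> x \<rho> \<sigma> m n =
     (-1) ^ n * (\<Delta> (m + n) * x ^ (m + n)) / (pochhammer \<rho> m * pochhammer \<sigma> n * fact m * fact n)"

text \<open>
  Equality of an iterated series and a series, including convergence of all series involved
  (\<^const>\<open>suminf\<close> alone is unspecified for divergent series).
\<close>

definition double_series_eq :: "(nat \<Rightarrow> nat \<Rightarrow> complex) \<Rightarrow> (nat \<Rightarrow> complex) \<Rightarrow> bool" where
  "double_series_eq t s \<longleftrightarrow>
     (\<forall>m. summable (\<lambda>n. t m n)) \<and> summable (\<lambda>m. \<Sum>n. t m n) \<and> summable s \<and>
     (\<Sum>m. \<Sum>n. t m n) = (\<Sum>m. s m)"

end

(*
  Collecting the terms with m + n = N on the left turns the factor of Delta_N x^N into a terminating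
  2F1(-N, 1 - rho - N; sigma; -1), in which the lower parameter differs from the one of Kummer's
  summation theorem by the integer +i or -i.  For i = 0 the value follows from recurrences in b (if b
  terminates the series) or in steps of two in a (if a does), both with explicit telescoping
  certificates.  Two contiguous relations at the argument -1 match Pascal's rule in the sums over r
  and give the value for every i by induction.  All this is carried out for 2 rho not an integer,
  where no Gamma factor is singular; the other rho follow by continuity, since half-integers are
  isolated and the left-hand coefficients are continuous in rho.
*)
theory Submission
  imports Defs
begin

subsection \<open>Contiguous relations for the hypergeometric series at $-1$\<close>

text \<open>The pair a = -m, b = 1 - rho - m has 1 + a - b = rho, and the swapped pair has 1 + a - b
  = 2 - rho. So the four identities are two evaluations of F(a, b; 1 + a - b +- i; -1), each read
  for both orders of the upper parameters. The series is symmetric in a and b but the Gamma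
  expression is not; this is why the case i = 0 is needed both for a terminating and for b
  terminating.

  This dictates the choice of contiguous relations: they only lower a and b. The conditions on a - b
  and a - 2b survive all integer shifts, so the induction on i never meets a singular Gamma factor.
  For the first pair a - 2b = 2 rho + m - 2, which is where half-integers enter as exceptional
  values.\<close>

definition hyp_term :: "complex \<Rightarrow> complex \<Rightarrow> complex \<Rightarrow> nat \<Rightarrow> complex" where
  "hyp_term a b c k = pochhammer a k * pochhammer b k / (pochhammer c k * fact k)"

definition hyp_neg1 :: "complex \<Rightarrow> complex \<Rightarrow> complex \<Rightarrow> complex" where
  "hyp_neg1 a b c = (\<Sum>k. hyp_term a b c k * (-1) ^ k)"

lemma pochhammer_nonpos_Int_eventually_0:
  fixes a :: complex
  assumes "a \<in> \<int>\<^sub>\<le>\<^sub>0"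
  shows "eventually (\<lambda>k. pochhammer a k = 0) sequentially"
proof -
  obtain n where "a = - of_nat n"
    using assms by (auto elim: nonpos_Ints_cases')
  then show ?thesis
    by (auto simp: pochhammer_of_nat_eq_0_iff intro: eventually_sequentiallyI[of "Suc n"])
qed

lemma pochhammer_neq_0:
  fixes a :: complex
  assumes "a \<notin> \<int>\<^sub>\<le>\<^sub>0"
  shows "pochhammer a k \<noteq> 0"
  using assms by (auto simp: pochhammer_eq_0_iff)

lemma hyp_term_eventually_0:
  assumes "a \<in> \<int>\<^sub>\<le>\<^sub>0 \<or> b \<in> \<int>\<^sub>\<le>\<^sub>0"
  shows "eventually (\<lambda>k. hyp_term a b c k = 0) sequentially"
  using assms
proof
  assume "a \<in> \<int>\<^sub>\<le>\<^sub>0"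
  from pochhammer_nonpos_Int_eventually_0[OF this] show ?thesis
    by eventually_elim (simp add: hyp_term_def)
next
  assume "b \<in> \<int>\<^sub>\<le>\<^sub>0"
  from pochhammer_nonpos_Int_eventually_0[OF this] show ?thesis
    by eventually_elim (simp add: hyp_term_def)
qed

lemma hyp_neg1_sums:
  assumes "a \<in> \<int>\<^sub>\<le>\<^sub>0 \<or> b \<in> \<int>\<^sub>\<le>\<^sub>0"
  shows "(\<lambda>k. hyp_term a b c k * (-1) ^ k) sums hyp_neg1 a b c"
proof -
  from hyp_term_eventually_0[OF assms, of c] obtain N
    where "\<And>k. k \<ge> N \<Longrightarrow> hyp_term a b c k = 0"
    by (auto simp: eventually_sequentially)
  then have "summable (\<lambda>k. hyp_term a b c k * (-1) ^ k)"
    by (intro summable_finite[of "{..<N}"]) auto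
  then show ?thesis
    unfolding hyp_neg1_def by (rule summable_sums)
qed

lemma hyp_neg1_commute: "hyp_neg1 a b c = hyp_neg1 b a c"
  by (simp add: hyp_neg1_def hyp_term_def mult.commute)

lemma hyp_neg1_0: "hyp_neg1 a 0 c = 1"
proof -
  have "hyp_neg1 a 0 c = (\<Sum>k\<in>{0}. hyp_term a 0 c k * (-1) ^ k)"
    unfolding hyp_neg1_def
    by (rule suminf_finite) (auto simp: hyp_term_def pochhammer_0_left)
  then show ?thesis
    by (simp add: hyp_term_def)
qed

section \<open>Linear relations at -1 proved by telescoping\<close>

lemma alternating_telescope_sums:
  fixes u :: "nat \<Rightarrow> complex"
  assumes "u 0 = 0" and "eventually (\<lambda>k. u k = 0) sequentially"
  shows "(\<lambda>k. (u (Suc k) + u k) * (-1) ^ k) sums 0"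
proof -
  have "(\<lambda>k. u k * (-1) ^ k) \<longlonglongrightarrow> 0"
    using assms(2) by (intro tendsto_eventually) (auto elim: eventually_mono)
  from telescope_sums[OF this]
  have "(\<lambda>k. - (u (Suc k) * (-1) ^ Suc k - u k * (-1) ^ k)) sums - (0 - u 0 * (-1) ^ 0)"
    by (rule sums_minus)
  then show ?thesis
    by (simp add: assms(1) algebra_simps)
qed

text \<open>Reduces a relation between three series to an identity between their k-th terms. Because
  of the sign \<open>(-1) ^ k\<close>, a telescoping difference appears as the sum
  \<open>u (Suc k) + u k\<close>; termination makes the boundary term at infinity vanish.\<close>

lemma hyp_neg1_relation:
  assumes ab: "a \<in> \<int>\<^sub>\<le>\<^sub>0 \<or> b \<in> \<int>\<^sub>\<le>\<^sub>0" "a' \<in> \<int>\<^sub>\<le>\<^sub>0 \<or> b' \<in> \<int>\<^sub>\<le>\<^sub>0" "a'' \<in> \<int>\<^sub>\<le>\<^sub>0 \<or> b'' \<in> \<int>\<^sub>\<le>\<^sub>0"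
  and u: "u 0 = 0" "eventually (\<lambda>k. u k = 0) sequentially"
  and eq: "\<And>k. p * hyp_term a b c k - q * hyp_term a' b' c' k - s * hyp_term a'' b'' c'' k
             = u (Suc k) + u k"
  shows "p * hyp_neg1 a b c = q * hyp_neg1 a' b' c' + s * hyp_neg1 a'' b'' c''"
proof -
  have "(\<lambda>k. p * (hyp_term a b c k * (-1) ^ k) - q * (hyp_term a' b' c' k * (-1) ^ k)
             - s * (hyp_term a'' b'' c'' k * (-1) ^ k))
          sums (p * hyp_neg1 a b c - q * hyp_neg1 a' b' c' - s * hyp_neg1 a'' b'' c'')"
    by (intro sums_diff sums_mult hyp_neg1_sums ab)
  also have "(\<lambda>k. p * (hyp_term a b c k * (-1) ^ k) - q * (hyp_term a' b' c' k * (-1) ^ k)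
             - s * (hyp_term a'' b'' c'' k * (-1) ^ k)) = (\<lambda>k. (u (Suc k) + u k) * (-1) ^ k)"
    unfolding eq[symmetric] by (simp add: algebra_simps)
  finally have "p * hyp_neg1 a b c - q * hyp_neg1 a' b' c' - s * hyp_neg1 a'' b'' c'' = 0"
    using alternating_telescope_sums[OF u] sums_unique2 by blast
  then show ?thesis
    by (simp add: algebra_simps)
qed

lemma hyp_term_Suc:
  "hyp_term a b c (Suc k) =
     hyp_term a b c k * ((a + of_nat k) * (b + of_nat k) / ((c + of_nat k) * (1 + of_nat k)))"
  by (simp add: hyp_term_def pochhammer_Suc mult_ac)

lemma not_Int_add_nat_nonzero:
  fixes c :: complex
  assumes "c \<notin> \<int>"
  shows "c + of_nat k \<noteq> 0"
  using assms by (metis Ints_minus Ints_of_nat add_eq_0_iff2)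

lemma not_Int_pochhammer_nonzero:
  fixes c :: complex
  assumes "c \<notin> \<int>"
  shows "pochhammer c k \<noteq> 0"
  using assms by (auto simp: pochhammer_eq_0_iff)

lemma eventually_nat_shift_0:
  assumes "eventually (\<lambda>k. f k = (0::complex)) sequentially"
  shows "eventually (\<lambda>k. f (k - 1) = 0) sequentially"
  using assms unfolding eventually_sequentially
  by (metis Suc_le_mono diff_Suc_1 le_Suc_ex add_Suc plus_nat.simps(2) add.commute le_add1)

text \<open>For general argument z one has (b-1)(1-z) F(a,b;c) = (c-1) F(a-1,b-1;c-1) - (c-b)
  F(a,b-1;c). At z = -1 the factor 1 - z becomes 2, and multiplication by z is the index shift
  recorded in \<open>u\<close>.\<close>

lemma contiguous_down:
  assumes ab: "a \<in> \<int>\<^sub>\<le>\<^sub>0 \<or> b \<in> \<int>\<^sub>\<le>\<^sub>0" "a - 1 \<in> \<int>\<^sub>\<le>\<^sub>0 \<or> b - 1 \<in> \<int>\<^sub>\<le>\<^sub>0" "a \<in> \<int>\<^sub>\<le>\<^sub>0 \<or> b - 1 \<in> \<int>\<^sub>\<le>\<^sub>0"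
    and c: "c \<notin> \<int>"
  shows "2 * (b - 1) * hyp_neg1 a b c =
           (c - 1) * hyp_neg1 (a - 1) (b - 1) (c - 1) - (c - b) * hyp_neg1 a (b - 1) c"
proof -
  define u where "u k = (if k = 0 then 0 else (b - 1) * hyp_term a b c (k - 1))" for k
  have "2 * (b - 1) * hyp_neg1 a b c =
          (c - 1) * hyp_neg1 (a - 1) (b - 1) (c - 1) + (b - c) * hyp_neg1 a (b - 1) c"
  proof (rule hyp_neg1_relation[OF ab])
    show "eventually (\<lambda>k. u k = 0) sequentially"
      using eventually_nat_shift_0[OF hyp_term_eventually_0[OF ab(1)], of c]
      by eventually_elim (simp add: u_def)
    fix k
    show "2 * (b - 1) * hyp_term a b c k - (c - 1) * hyp_term (a - 1) (b - 1) (c - 1) k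
            - (b - c) * hyp_term a (b - 1) c k = u (Suc k) + u k"
    proof (cases k)
      case 0
      then show ?thesis by (simp add: u_def hyp_term_def algebra_simps)
    next
      case (Suc j)
      \<comment> \<open>All terms are written as rational multiples of the same Pochhammer values at
        \<open>j\<close>. These cancel, and a polynomial identity in a, b, c and j remains.\<close>
      define A B C where "A = pochhammer a j" "B = pochhammer b j" "C = pochhammer c j"
      have nz: "C \<noteq> 0" "c + of_nat j \<noteq> 0" "(1 + of_nat j :: complex) \<noteq> 0" "c - 1 \<noteq> 0"
        using not_Int_add_nat_nonzero[OF c, of j] not_Int_pochhammer_nonzero[OF c, of j] c of_nat_neq_0[of j, where ?'a = complex] by (auto simp: A_B_C_def)
      have 1: "hyp_term a b c j = A * B / (C * fact j)"
        by (simp add: hyp_term_def A_B_C_def)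
      have 2: "hyp_term a b c k = A * B * (a + of_nat j) * (b + of_nat j) / (C * fact j * (c + of_nat j) * (1 + of_nat j))"
        unfolding Suc hyp_term_Suc 1 by (simp add: mult_ac)
      have 3: "hyp_term (a - 1) (b - 1) (c - 1) k = (a - 1) * (b - 1) * A * B / ((c - 1) * C * fact j * (1 + of_nat j))"
        by (simp add: hyp_term_def Suc pochhammer_rec A_B_C_def mult_ac)
      have 4: "hyp_term a (b - 1) c k = A * B * (a + of_nat j) * (b - 1) / (C * fact j * (c + of_nat j) * (1 + of_nat j))"
        unfolding Suc hyp_term_def pochhammer_rec[of "b - 1"] pochhammer_Suc[of a] pochhammer_Suc[of c]
        by (simp add: A_B_C_def mult_ac)
      have 5: "u (Suc k) + u k = (b - 1) * (hyp_term a b c k + hyp_term a b c j)"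
        by (simp add: u_def Suc algebra_simps)
      show ?thesis
        unfolding 5 unfolding 1 2 3 4 using nz
        apply (simp add: divide_simps) by algebra
    qed
  qed (simp add: u_def)
  then show ?thesis by (simp add: algebra_simps)
qed

text \<open>For general z, F(a,b;c) - F(a-1,b;c) = z (F(a,b;c) - (c-b)/c F(a,b;c+1)). Setting z = -1
  gives the claim; the bracket, shifted by one index, is the certificate \<open>u\<close>.\<close>

lemma contiguous_up:
  assumes ab: "a \<in> \<int>\<^sub>\<le>\<^sub>0 \<or> b \<in> \<int>\<^sub>\<le>\<^sub>0" "a - 1 \<in> \<int>\<^sub>\<le>\<^sub>0 \<or> b \<in> \<int>\<^sub>\<le>\<^sub>0"
    and c: "c \<notin> \<int>"
  shows "2 * hyp_neg1 a b c = hyp_neg1 (a - 1) b c + (c - b) / c * hyp_neg1 a b (c + 1)"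
proof -
  define u where "u k = (if k = 0 then 0 else
    hyp_term a b c (k - 1) - (c - b) / c * hyp_term a b (c + 1) (k - 1))" for k
  have "2 * hyp_neg1 a b c =
          1 * hyp_neg1 (a - 1) b c + (c - b) / c * hyp_neg1 a b (c + 1)"
  proof (rule hyp_neg1_relation[OF ab(1,2,1)])
    show "eventually (\<lambda>k. u k = 0) sequentially"
      using eventually_nat_shift_0[OF hyp_term_eventually_0[OF ab(1)], of c]
            eventually_nat_shift_0[OF hyp_term_eventually_0[OF ab(1)], of "c + 1"]
      by eventually_elim (simp add: u_def)
    fix k
    show "2 * hyp_term a b c k - 1 * hyp_term (a - 1) b c k
            - (c - b) / c * hyp_term a b (c + 1) k = u (Suc k) + u k"
    proof (cases k)
      case 0
      then show ?thesis by (simp add: u_def hyp_term_def)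
    next
      case (Suc j)
      define A B C where "A = pochhammer a j" "B = pochhammer b j" "C = pochhammer (c + 1) j"
      have nz: "C \<noteq> 0" "c + 1 + of_nat j \<noteq> 0" "(1 + of_nat j :: complex) \<noteq> 0" "c \<noteq> 0"
           "c + of_nat j \<noteq> 0"
        using not_Int_add_nat_nonzero[OF c, of j] not_Int_add_nat_nonzero[of "c + 1" j]
          not_Int_pochhammer_nonzero[of "c + 1" j] c
          of_nat_neq_0[of j, where ?'a = complex] by (auto simp: A_B_C_def)
      \<comment> \<open>Both lower parameters c and c + 1 occur, so every Pochhammer value in them
        is reduced to the one starting at c + 1.\<close>
      have cj: "pochhammer c j = c * C / (c + of_nat j)"
        using pochhammer_rec[of c j] pochhammer_Suc[of c j] nz by (simp add: A_B_C_def field_simps)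
      have 1: "hyp_term a b c j = A * B * (c + of_nat j) / (c * C * fact j)"
        by (simp add: hyp_term_def A_B_C_def(1,2) cj)
      have 2: "hyp_term a b c k = A * B * (a + of_nat j) * (b + of_nat j) / (c * C * fact j * (1 + of_nat j))"
        unfolding Suc hyp_term_Suc 1 using nz by (simp add: mult_ac)
      have 3: "hyp_term (a - 1) b c k = (a - 1) * A * (b + of_nat j) * B / (c * C * fact j * (1 + of_nat j))"
        unfolding Suc hyp_term_def pochhammer_rec[of "a - 1"] pochhammer_rec[of c] pochhammer_Suc[of b]
        by (simp add: A_B_C_def mult_ac)
      have 4: "hyp_term a b (c + 1) j = A * B / (C * fact j)"
        by (simp add: hyp_term_def A_B_C_def)
      have 5: "hyp_term a b (c + 1) k = A * B * (a + of_nat j) * (b + of_nat j) / (C * fact j * (c + 1 + of_nat j) * (1 + of_nat j))"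
        unfolding Suc hyp_term_Suc 4 by (simp add: mult_ac)
      have 6: "u (Suc k) + u k = hyp_term a b c k - (c - b) / c * hyp_term a b (c + 1) k +
         (hyp_term a b c j - (c - b) / c * hyp_term a b (c + 1) j)"
        by (simp add: u_def Suc algebra_simps)
      have 7: "hyp_term a b c k - hyp_term (a - 1) b c k = hyp_term a b c j - (c - b) / c * hyp_term a b (c + 1) j"
        unfolding 1 2 3 4 using nz
        apply (simp add: divide_simps) by algebra
      show ?thesis
        unfolding 6 using 7 by algebra
    qed
  qed (simp add: u_def)
  then show ?thesis by simp
qed

text \<open>
  The sequences \<open>u\<close> in the next two proofs are certificates found by Zeilberger's method.
\<close>

lemma kummer_step_b:
  assumes ab: "a \<in> \<int>\<^sub>\<le>\<^sub>0 \<or> b \<in> \<int>\<^sub>\<le>\<^sub>0" "a \<in> \<int>\<^sub>\<le>\<^sub>0 \<or> b + 1 \<in> \<int>\<^sub>\<le>\<^sub>0"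
    and c: "a - b \<notin> \<int>"
  shows "(a / 2 - b) * hyp_neg1 a b (1 + a - b) = (a - b) * hyp_neg1 a (b + 1) (a - b)"
proof -
  define u where "u k = (if k = 0 then 0 else
    - (1/2) * pochhammer a k * pochhammer (b + 1) (k - 1) /
       (pochhammer (1 + a - b) (k - 1) * fact (k - 1)))" for k
  have "(a / 2 - b) * hyp_neg1 a b (1 + a - b) = (a - b) * hyp_neg1 a (b + 1) (a - b) + 0 * hyp_neg1 a b (1 + a - b)"
  proof (rule hyp_neg1_relation[OF ab(1,2,1)])
    have "eventually (\<lambda>k. pochhammer a k * pochhammer (b + 1) (k - 1) = 0) sequentially"
    proof (cases "a \<in> \<int>\<^sub>\<le>\<^sub>0")
      case True
      from pochhammer_nonpos_Int_eventually_0[OF this] show ?thesis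
        by eventually_elim simp
    next
      case False
      with ab have "b + 1 \<in> \<int>\<^sub>\<le>\<^sub>0" by simp
      from eventually_nat_shift_0[OF pochhammer_nonpos_Int_eventually_0[OF this]] show ?thesis
        by eventually_elim simp
    qed
    then show "eventually (\<lambda>k. u k = 0) sequentially"
      by eventually_elim (auto simp: u_def)
    fix k
    show "(a / 2 - b) * hyp_term a b (1 + a - b) k - (a - b) * hyp_term a (b + 1) (a - b) k -
           0 * hyp_term a b (1 + a - b) k = u (Suc k) + u k"
    proof (cases k)
      case 0
      then show ?thesis by (simp add: u_def hyp_term_def)
    next
      case (Suc j)
      define c where "c = a - b"
      define A B C where "A = pochhammer a j" "B = pochhammer (b + 1) j" "C = pochhammer (1 + c) j"
      have b: "b = a - c" by (simp add: c_def)
      have nz: "C \<noteq> 0" "1 + c + of_nat j \<noteq> 0" "(1 + of_nat j :: complex) \<noteq> 0" "c \<noteq> 0"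
        using not_Int_add_nat_nonzero[of "1 + c" j] not_Int_pochhammer_nonzero[of "1 + c" j] assms(3)
          of_nat_neq_0[of j, where ?'a = complex] by (auto simp: A_B_C_def c_def add.commute)
      have 1: "hyp_term a b (1 + a - b) k =
          A * (a + of_nat j) * b * B / (C * (1 + c + of_nat j) * fact j * (1 + of_nat j))"
        unfolding Suc hyp_term_def pochhammer_rec[of b] pochhammer_Suc[of a] pochhammer_Suc[of "1 + a - b"]
        by (simp add: A_B_C_def c_def add_diff_eq mult_ac)
      have 2: "hyp_term a (b + 1) (a - b) k = A * (a + of_nat j) * B * (b + 1 + of_nat j) / (c * C * fact j * (1 + of_nat j))"
        unfolding Suc hyp_term_def pochhammer_rec[of "a - b"] pochhammer_Suc[of "b + 1"] pochhammer_Suc[of a]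
        by (simp add: A_B_C_def c_def add.commute mult_ac)
      have 3: "u k = - (1/2) * (A * (a + of_nat j) * B / (C * fact j))"
        unfolding u_def Suc pochhammer_Suc[of a] by (simp add: A_B_C_def c_def add_diff_eq)
      have 4: "u (Suc k) = - (1/2) * (A * (a + of_nat j) * (a + 1 + of_nat j) * B * (b + 1 + of_nat j) /
            (C * (1 + c + of_nat j) * fact j * (1 + of_nat j)))"
        unfolding u_def Suc pochhammer_Suc
        by (simp add: A_B_C_def c_def add_diff_eq pochhammer_Suc add_ac mult_ac)
      show ?thesis
        unfolding 1 2 3 4 unfolding c_def[symmetric] b using nz
        apply (simp add: divide_simps) by algebra
    qed
  qed (simp add: u_def)
  then show ?thesis by simp
qed

lemma kummer_step_a:
  assumes ab: "a \<in> \<int>\<^sub>\<le>\<^sub>0" "a + 2 \<in> \<int>\<^sub>\<le>\<^sub>0"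
    and c: "a - b \<notin> \<int>"
  shows "(a + 2 - b) * (a + 1 - b) * hyp_neg1 a b (1 + a - b) =
           (a + 2 - 2 * b) * (a + 1) * hyp_neg1 (a + 2) b (3 + a - b)"
proof -
  define u where "u k = (if k = 0 then 0 else
    (b - 1) * pochhammer (a + 1) (k - 1) * pochhammer b k /
       (pochhammer (3 + a - b) (k - 1) * fact (k - 1)))" for k
  have "(a + 2 - b) * (a + 1 - b) * hyp_neg1 a b (1 + a - b) =
           (a + 2 - 2 * b) * (a + 1) * hyp_neg1 (a + 2) b (3 + a - b) + 0 * hyp_neg1 a b (1 + a - b)"
  proof (rule hyp_neg1_relation)
    \<comment> \<open>The certificate contains \<open>pochhammer (a + 1) (k - 1)\<close>, so it is a
      + 1 that must be a nonpositive integer. Since a + 2 is one, a is at most -2.\<close>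
    have "a \<noteq> 0" using ab by auto
    obtain n where "a = - of_nat n" using ab(1) by (auto elim: nonpos_Ints_cases')
    then have "a + 1 = - of_nat (n - 1)" using \<open>a \<noteq> 0\<close> by (cases n) auto
    then have "a + 1 \<in> \<int>\<^sub>\<le>\<^sub>0" by simp
    from eventually_nat_shift_0[OF pochhammer_nonpos_Int_eventually_0[OF this]]
    show "eventually (\<lambda>k. u k = 0) sequentially"
      by eventually_elim (auto simp: u_def)
    fix k
    define c where "c = 1 + a - b"
    have b: "b = 1 + a - c" by (simp add: c_def)
    have c: "c \<notin> \<int>" using assms(3) Ints_diff[of c 1] by (auto simp: c_def)
    show "(a + 2 - b) * (a + 1 - b) * hyp_term a b (1 + a - b) k -
       (a + 2 - 2 * b) * (a + 1) * hyp_term (a + 2) b (3 + a - b) k -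
           0 * hyp_term a b (1 + a - b) k = u (Suc k) + u k"
    proof (cases k)
      case 0
      then show ?thesis by (simp add: u_def hyp_term_def algebra_simps)
    next
      case (Suc j)
      define A B C where "A = pochhammer (a + 1) j" "B = pochhammer b (Suc j)" "C = pochhammer (c + 2) j"
      have nz: "C \<noteq> 0" "c + 2 + of_nat j \<noteq> 0" "(1 + of_nat j :: complex) \<noteq> 0" "c \<noteq> 0"
         "c + 1 \<noteq> 0" "c + 1 + of_nat j \<noteq> 0"
        using not_Int_add_nat_nonzero[OF c, of 1] not_Int_add_nat_nonzero[of "c + 2" j]
          not_Int_add_nat_nonzero[of "c + 1" j] not_Int_pochhammer_nonzero[of "c + 2" j] c
          of_nat_neq_0[of j, where ?'a = complex] by (auto simp: A_B_C_def)
      have cj: "pochhammer c (Suc j) = c * (c + 1) * C / (c + 1 + of_nat j)"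
      proof -
        have "pochhammer (c + 1) j * (c + 1 + of_nat j) = (c + 1) * C"
          using pochhammer_rec[of "c + 1" j] pochhammer_Suc[of "c + 1" j]
          by (simp add: A_B_C_def add.assoc)
        then have "pochhammer (c + 1) j = (c + 1) * C / (c + 1 + of_nat j)"
          using nz(6) by (simp add: eq_divide_eq)
        then show ?thesis
          unfolding pochhammer_rec[of c] by simp
      qed
      have a2: "(a + 1) * pochhammer (a + 2) (Suc j) = A * (a + 1 + of_nat j) * (a + 2 + of_nat j)"
        using pochhammer_rec[of "a + 1" "Suc j"] pochhammer_Suc[of "a + 1" "Suc j"] pochhammer_Suc[of "a + 1" j]
        by (simp add: A_B_C_def add_ac)
      have 1: "hyp_term a b (1 + a - b) k =
          a * A * B * (c + 1 + of_nat j) / (c * (c + 1) * C * fact j * (1 + of_nat j))"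
        unfolding Suc hyp_term_def c_def[symmetric] cj pochhammer_rec[of a]
        by (simp add: A_B_C_def(1,2))
      have "(a + 1) * hyp_term (a + 2) b (3 + a - b) k
           = (a + 1) * pochhammer (a + 2) (Suc j) * B / (pochhammer (c + 2) (Suc j) * fact (Suc j))"
        by (simp add: hyp_term_def c_def A_B_C_def Suc algebra_simps)
      also have "\<dots> = A * (a + 1 + of_nat j) * (a + 2 + of_nat j) * B /
             (C * (c + 2 + of_nat j) * fact j * (1 + of_nat j))"
        unfolding a2 pochhammer_Suc[of "c + 2"] by (simp add: A_B_C_def mult_ac)
      finally have 2: "(a + 2 - 2 * b) * (a + 1) * hyp_term (a + 2) b (3 + a - b) k =
         (a + 2 - 2 * b) * (A * (a + 1 + of_nat j) * (a + 2 + of_nat j) * B /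
             (C * (c + 2 + of_nat j) * fact j * (1 + of_nat j)))"
        by (simp add: mult.assoc)
      have c2: "3 + a - b = c + 2" by (simp add: c_def)
      have 3: "u k = (b - 1) * (A * B / (C * fact j))"
        unfolding u_def Suc c2 by (simp add: A_B_C_def)
      have 4: "u (Suc k) = (b - 1) * (A * (a + 1 + of_nat j) * B * (b + 1 + of_nat j) /
            (C * (c + 2 + of_nat j) * fact j * (1 + of_nat j)))"
        unfolding u_def Suc c2 pochhammer_Suc[of b "Suc j"]
        by (simp add: A_B_C_def pochhammer_Suc[of "1 + a"] pochhammer_Suc[of "c + 2"] add_ac mult_ac)
      show ?thesis
        unfolding 2 unfolding 1 3 4 unfolding b using nz
        apply (simp add: divide_simps) by algebra
    qed
  qed (use ab in \<open>simp_all add: u_def\<close>)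
  then show ?thesis by simp
qed

subsection \<open>Generalized Kummer summation\<close>

text \<open>
  The two non-integrality conditions keep the lower parameter and all Gamma factors in numerators
  away from their singularities, and are stable under integer shifts of the parameters.
\<close>

definition kummer_generic :: "complex \<Rightarrow> complex \<Rightarrow> bool" where
  "kummer_generic a b \<longleftrightarrow> a - b \<notin> \<int> \<and> a - 2 * b \<notin> \<int> \<and> (a \<in> \<int>\<^sub>\<le>\<^sub>0 \<or> b \<in> \<int>\<^sub>\<le>\<^sub>0)"

text \<open>Kummer's value Gamma(1+a-b) Gamma(1+a/2) / (Gamma(1+a) Gamma(1+a/2-b)), with
  Gamma(1+a/2) / Gamma(1+a) rewritten by the duplication formula. In this form a = -n causes no pole
  in a numerator.\<close>

definition kummer_gamma :: "complex \<Rightarrow> complex \<Rightarrow> complex" where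
  "kummer_gamma a b = 2 powr (- a) * Gamma (1/2) * Gamma (1 + a - b) *
     rGamma (a / 2 - b + 1) * rGamma (a / 2 + 1/2)"

lemma Int_add_iff:
  fixes z :: "'a::ring_1"
  assumes "n \<in> \<int>"
  shows "z + n \<in> \<int> \<longleftrightarrow> z \<in> \<int>"
  using assms by (metis Ints_add Ints_diff add_diff_cancel_right')

lemma not_Int_shift:
  fixes z w :: complex
  assumes "z \<notin> \<int>" "w - z \<in> \<int>"
  shows "w \<notin> \<int>"
  using assms Int_add_iff[of "w - z" z] by simp

lemma nonpos_Int_minus_1: "a \<in> \<int>\<^sub>\<le>\<^sub>0 \<Longrightarrow> a - 1 \<in> (\<int>\<^sub>\<le>\<^sub>0 :: complex set)"
proof (elim nonpos_Ints_cases')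
  fix n assume "a = - of_nat n"
  then have "a - 1 = - of_nat (Suc n)" by simp
  then show ?thesis by (metis minus_of_nat_in_nonpos_Ints)
qed

lemma not_Int_not_nonpos: "(z::complex) \<notin> \<int> \<Longrightarrow> z \<notin> \<int>\<^sub>\<le>\<^sub>0"
  by (auto elim: nonpos_Ints_cases)

lemma Gamma_times_rGamma: "z \<notin> \<int>\<^sub>\<le>\<^sub>0 \<Longrightarrow> Gamma z * rGamma z = (1::complex)"
  by (simp add: rGamma_inverse_Gamma Gamma_eq_zero_iff)

text \<open>Only downward shifts are considered: they keep a nonpositive integer nonpositive, so
  termination is inherited. These are the upper parameters that the two contiguous relations
  produce.\<close>

lemma kummer_generic_down:
  assumes "kummer_generic a b"
  shows "kummer_generic (a - 1) (b - 1)" "kummer_generic a (b - 1)" "kummer_generic (a - 1) b"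
  using assms nonpos_Int_minus_1
    not_Int_shift[of "a - b" "a - 1 - (b - 1)"] not_Int_shift[of "a - b" "a - 1 - b"]
    not_Int_shift[of "a - b" "a - (b - 1)"] not_Int_shift[of "a - 2 * b" "a - 1 - 2 * (b - 1)"]
    not_Int_shift[of "a - 2 * b" "a - 1 - 2 * b"] not_Int_shift[of "a - 2 * b" "a - 2 * (b - 1)"]
  by (auto simp: kummer_generic_def algebra_simps)

lemma kummer_neg_b:
  assumes "a \<notin> \<int>"
  shows "hyp_neg1 a (- of_nat n) (1 + a + of_nat n) = kummer_gamma a (- of_nat n)"
proof (induction n)
  case 0
  \<comment> \<open>At b = 0 the series is 1, and the duplication formula at this z says exactly
    that the closed form is 1 as well.\<close>
  define z where "z = a / 2 + 1/2"
  have 2: "2 * z \<notin> \<int>" "2 * (z + 1/2) \<notin> \<int>"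
    using not_Int_shift[OF assms, of "a + 1"] not_Int_shift[OF assms, of "a + 2"]
    by (auto simp: z_def algebra_simps)
  have "z \<notin> \<int>" "z + 1/2 \<notin> \<int>"
    using 2 Ints_mult[of 2 z] Ints_mult[of 2 "z + 1/2"] by (metis Ints_numeral)+
  then have z: "z \<notin> \<int>\<^sub>\<le>\<^sub>0" "z + 1/2 \<notin> \<int>\<^sub>\<le>\<^sub>0"
    by (simp_all add: not_Int_not_nonpos)
  have "Gamma z * Gamma (z + 1/2) = 2 powr (- a) * Gamma (1/2) * Gamma (1 + a)"
    using Gamma_legendre_duplication[OF z]
    by (simp add: powr_def Gamma_one_half_complex z_def add_ac Ln_of_real[symmetric])
  then have "kummer_gamma a 0 = (Gamma z * rGamma z) * (Gamma (z + 1/2) * rGamma (z + 1/2))"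
    by (simp add: kummer_gamma_def z_def mult_ac add_ac)
  also have "\<dots> = 1"
    using z by (simp add: Gamma_times_rGamma)
  finally show ?case
    by (simp add: hyp_neg1_0)
next
  case (Suc n)
  define b where "b = (- of_nat n :: complex)"
  have ab: "a - b \<notin> \<int>" "a / 2 - b + 1 \<noteq> 0"
  proof -
    show "a - b \<notin> \<int>"
      using not_Int_shift[OF assms, of "a - b"] by (simp add: b_def)
    show "a / 2 - b + 1 \<noteq> 0"
    proof
      assume "a / 2 - b + 1 = 0"
      moreover have "a = 2 * (a / 2 - b + 1) + 2 * (b - 1)" by (simp add: algebra_simps)
      ultimately have "a = 2 * (b - 1)" by simp
      then have "a = of_int (2 * (- int n - 1))" by (simp add: b_def)
      with assms show False by (metis Ints_of_int)
    qed
  qed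
  have b_Suc: "- of_nat (Suc n) = b - 1" "b \<in> \<int>\<^sub>\<le>\<^sub>0" "b - 1 \<in> \<int>\<^sub>\<le>\<^sub>0"
    using nonpos_Int_minus_1[of b] by (simp_all add: b_def)
  have "(a / 2 - b + 1) * hyp_neg1 a (b - 1) (2 + a - b) = (1 + a - b) * hyp_neg1 a b (1 + a - b)"
    using kummer_step_b[of a "b - 1"] b_Suc not_Int_shift[OF ab(1), of "a - (b - 1)"]
    by (simp add: algebra_simps)
  also have "hyp_neg1 a b (1 + a - b) = kummer_gamma a b"
    using Suc by (simp add: b_def)
  also have "(1 + a - b) * kummer_gamma a b = (a / 2 - b + 1) * kummer_gamma a (b - 1)"
  proof -
    have 1: "Gamma (1 + a - (b - 1)) = (1 + a - b) * Gamma (1 + a - b)"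
      using Gamma_plus1[of "1 + a - b"] not_Int_shift[OF ab(1), of "1 + a - b"]
      by (simp add: not_Int_not_nonpos algebra_simps)
    have 2: "rGamma (a / 2 - b + 1) = (a / 2 - b + 1) * rGamma (a / 2 - (b - 1) + 1)"
      using rGamma_plus1[of "a / 2 - b + 1"] by (simp add: algebra_simps)
    show ?thesis
      unfolding kummer_gamma_def 1 2 by (simp only: mult_ac)
  qed
  finally have "hyp_neg1 a (b - 1) (2 + a - b) = kummer_gamma a (b - 1)"
    using ab(2) by simp
  then show ?case
    unfolding b_Suc(1) by (simp add: b_def add_ac)
qed

text \<open>Lowering a by one would change a/2 by one half, and the Gamma quotient would not change
  by a rational factor. Hence the induction runs in steps of two, with n = 0 and n = 1 as starting
  values.\<close>

lemma kummer_neg_a: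
  assumes "b \<notin> \<int>"
  shows "hyp_neg1 (- of_nat n) b (1 - of_nat n - b) = kummer_gamma (- of_nat n) b"
proof (induction n rule: less_induct)
  case (less n)
  consider "n = 0" | "n = 1" | m where "n = Suc (Suc m)"
    by (metis One_nat_def not0_implies_Suc)
  then show ?case
  proof cases
    case 1
    have "1 - b \<notin> \<int>\<^sub>\<le>\<^sub>0" "(1/2 :: complex) \<notin> \<int>\<^sub>\<le>\<^sub>0"
      using not_Int_shift[of "- b" "1 - b"] assms fraction_not_in_Ints[where 'a = complex, of 2 1]
      by (auto simp: not_Int_not_nonpos)
    then have "kummer_gamma 0 b = 1"
      using Gamma_times_rGamma[of "1 - b"] Gamma_times_rGamma[of "1/2"]
      by (simp add: kummer_gamma_def add_ac mult_ac)
    then show ?thesis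
      using 1 by (simp add: hyp_neg1_commute[of 0] hyp_neg1_0)
  next
    case 2
    have "hyp_neg1 (-1) b (- b) = (\<Sum>k\<in>{0,1}. hyp_term (-1) b (- b) k * (-1) ^ k)"
      unfolding hyp_neg1_def
    proof (rule suminf_finite)
      fix k :: nat assume "k \<notin> {0, 1}"
      then have "pochhammer (-1 :: complex) k = 0"
        using pochhammer_of_nat_eq_0_iff[of 1 k, where 'a = complex] by auto
      then show "hyp_term (-1) b (- b) k * (-1) ^ k = 0"
        by (simp add: hyp_term_def)
    qed auto
    also have "\<dots> = 0"
      using assms by (auto simp: hyp_term_def)
    \<comment> \<open>The closed form vanishes too: at a = -1 it contains the factor
      \<open>rGamma 0\<close>.\<close>
    also have "\<dots> = kummer_gamma (-1) b"
      by (simp add: kummer_gamma_def)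
    finally show ?thesis
      using 2 by simp
  next
    case 3
    define a where "a = (- of_nat n :: complex)"
    have a2: "a + 2 = - of_nat m"
      by (simp add: a_def 3)
    have a: "a \<in> \<int>\<^sub>\<le>\<^sub>0" "a + 2 \<in> \<int>\<^sub>\<le>\<^sub>0"
      unfolding a2 by (simp_all add: a_def)
    have ab: "a - b \<notin> \<int>"
      using not_Int_shift[of "- b" "a - b"] assms by (simp add: a_def)
    have ab12: "a + 1 - b \<notin> \<int>" "a + 2 - b \<notin> \<int>"
      using not_Int_shift[OF ab] by simp_all
    have "(a + 2 - b) * (a + 1 - b) * hyp_neg1 a b (1 + a - b) =
           (a + 2 - 2 * b) * (a + 1) * hyp_neg1 (a + 2) b (3 + a - b)"
      by (rule kummer_step_a[OF a(1,2) ab])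
    also have "3 + a - b = 1 - of_nat m - b"
      by (simp add: a_def 3)
    also have "hyp_neg1 (a + 2) b (1 - of_nat m - b) = kummer_gamma (a + 2) b"
      unfolding a2 by (rule less) (simp add: 3)
    \<comment> \<open>Each coefficient is twice the argument of an \<open>rGamma\<close> factor of
      \<open>kummer_gamma a b\<close>, so the recurrence of \<open>rGamma\<close> absorbs it. The
      remaining 4 comes from shifting the exponent of 2 by two.\<close>
    also have "(a + 2 - 2 * b) * (a + 1) * kummer_gamma (a + 2) b =
                (2 * (a / 2 - b + 1)) * (2 * (a / 2 + 1/2)) * kummer_gamma (a + 2) b"
      by (simp add: algebra_simps)
    also have "\<dots> = (a + 2 - b) * (a + 1 - b) * kummer_gamma a b"
    proof -
      have 1: "Gamma (1 + (a + 2) - b) = (a + 2 - b) * ((a + 1 - b) * Gamma (1 + a - b))"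
      proof -
        have "Gamma (a + 2 - b + 1) = (a + 2 - b) * Gamma (a + 1 - b + 1)"
          using Gamma_plus1[of "a + 2 - b"] ab12(2) by (simp add: not_Int_not_nonpos algebra_simps)
        also have "Gamma (a + 1 - b + 1) = (a + 1 - b) * Gamma (a + 1 - b)"
          using Gamma_plus1[of "a + 1 - b"] ab12(1) by (simp only: not_Int_not_nonpos not_False_eq_True)
        finally show ?thesis
          by (simp add: algebra_simps)
      qed
      have 2: "rGamma (a / 2 - b + 1) = (a / 2 - b + 1) * rGamma ((a + 2) / 2 - b + 1)"
        using rGamma_plus1[of "a / 2 - b + 1"] by (simp add: add_divide_distrib algebra_simps)
      have 3: "rGamma (a / 2 + 1/2) = (a / 2 + 1/2) * rGamma ((a + 2) / 2 + 1/2)"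
        using rGamma_plus1[of "a / 2 + 1/2"] by (simp add: add_divide_distrib algebra_simps)
      have 4: "2 powr (- a) = 4 * 2 powr (- (a + 2))"
        using powr_add[of "2::complex" "- (a + 2)" 2] by simp
      have "(2 * p) * (2 * q) * (w * g * (u * (v * G)) * R * S) =
              u * v * ((4 * w) * g * G * (p * R) * (q * S))" for p q w g u v G R S :: complex
        by simp
      then show ?thesis
        unfolding kummer_gamma_def 1 2 3 4 .
    qed
    finally have "hyp_neg1 a b (1 + a - b) = kummer_gamma a b"
      using ab12 by auto
    then show ?thesis
      by (simp add: a_def)
  qed
qed

lemma kummer:
  assumes "kummer_generic a b"
  shows "hyp_neg1 a b (1 + a - b) = kummer_gamma a b"
proof (cases "b \<in> \<int>\<^sub>\<le>\<^sub>0")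
  case True
  then obtain n where n: "b = - of_nat n" by (auto elim: nonpos_Ints_cases')
  have "a - b \<notin> \<int>"
    using assms by (simp add: kummer_generic_def)
  then have "a \<notin> \<int>"
    by (rule not_Int_shift) (simp add: n)
  from kummer_neg_b[OF this, of n] show ?thesis
    by (simp add: n)
next
  case False
  with assms obtain n where n: "a = - of_nat n"
    by (auto simp: kummer_generic_def elim: nonpos_Ints_cases')
  have "a - b \<notin> \<int>"
    using assms by (simp add: kummer_generic_def)
  then have "- b \<notin> \<int>"
    by (rule not_Int_shift) (simp add: n)
  from kummer_neg_a[of b n] this show ?thesis
    by (simp add: n)
qed

section \<open>Binomial sums of Gamma quotients and the induction on i\<close>

lemma sum_binomial_Suc:
  fixes f :: "nat \<Rightarrow> complex"
  shows "(\<Sum>r\<le>Suc n. of_nat (Suc n choose r) * f r) =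
           (\<Sum>r\<le>n. of_nat (n choose r) * f r) + (\<Sum>r\<le>n. of_nat (n choose r) * f (Suc r))"
proof -
  have "(\<Sum>r\<le>Suc n. of_nat (Suc n choose r) * f r) =
          f 0 + (\<Sum>r\<le>n. of_nat (n choose Suc r) * f (Suc r)) + (\<Sum>r\<le>n. of_nat (n choose r) * f (Suc r))"
    by (simp add: sum.atMost_Suc_shift sum.distrib ring_distribs del: sum.atMost_Suc)
  also have "f 0 + (\<Sum>r\<le>n. of_nat (n choose Suc r) * f (Suc r)) = (\<Sum>r\<le>Suc n. of_nat (n choose r) * f r)"
    by (simp add: sum.atMost_Suc_shift del: sum.atMost_Suc)
  finally show ?thesis
    by (simp add: binomial_eq_0)
qed

definition kummer_sum_up :: "nat \<Rightarrow> complex \<Rightarrow> complex \<Rightarrow> complex" where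
  "kummer_sum_up i a b = (\<Sum>r\<le>i. of_nat (i choose r) * ((-1) ^ r *
     Gamma (a / 2 - b + of_nat i / 2 + of_nat r / 2 + 1/2) *
     rGamma (a / 2 - of_nat i / 2 + of_nat r / 2 + 1/2)))"

definition kummer_sum_down :: "nat \<Rightarrow> complex \<Rightarrow> complex \<Rightarrow> complex" where
  "kummer_sum_down i a b = (\<Sum>r\<le>i. of_nat (i choose r) * (
     Gamma (a / 2 - b - of_nat i / 2 + of_nat r / 2 + 1/2) *
     rGamma (a / 2 - of_nat i / 2 + of_nat r / 2 + 1/2)))"

text \<open>A summand for i + 1 at (a, b) has the same Gamma arguments as one for i at (a-1, b-1),
  and replacing r by r + 1 there amounts to raising a by one. Pascal's rule therefore splits the
  sum; the sign \<open>(-1) ^ r\<close> yields the minus.\<close>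

lemma kummer_sum_up_Suc:
  "kummer_sum_up (Suc i) a b = kummer_sum_up i (a - 1) (b - 1) - kummer_sum_up i a (b - 1)"
proof -
  define f where "f r = (-1) ^ r * Gamma (a / 2 - b + of_nat (Suc i) / 2 + of_nat r / 2 + 1/2) *
     rGamma (a / 2 - of_nat (Suc i) / 2 + of_nat r / 2 + 1/2)" for r
  have args: "a / 2 - b + of_nat (Suc i) / 2 + of_nat r / 2 + 1/2
          = (a - 1) / 2 - (b - 1) + of_nat i / 2 + of_nat r / 2 + 1/2"
       "a / 2 - of_nat (Suc i) / 2 + of_nat r / 2 + 1/2 = (a - 1) / 2 - of_nat i / 2 + of_nat r / 2 + 1/2"
       "(a - 1) / 2 - (b - 1) + of_nat i / 2 + of_nat (Suc r) / 2 + 1/2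
          = a / 2 - (b - 1) + of_nat i / 2 + of_nat r / 2 + 1/2"
       "(a - 1) / 2 - of_nat i / 2 + of_nat (Suc r) / 2 + 1/2 = a / 2 - of_nat i / 2 + of_nat r / 2 + 1/2"
    for r
    by (simp_all add: field_simps)
  have "kummer_sum_up (Suc i) a b =
          (\<Sum>r\<le>i. of_nat (i choose r) * f r) + (\<Sum>r\<le>i. of_nat (i choose r) * f (Suc r))"
    unfolding kummer_sum_up_def f_def by (rule sum_binomial_Suc)
  also have "\<dots> = (\<Sum>r\<le>i. of_nat (i choose r) * f r) - (\<Sum>r\<le>i. of_nat (i choose r) * - f (Suc r))"
    by (simp add: sum_negf)
  finally show ?thesis
    unfolding kummer_sum_up_def f_def args power_Suc by simp
qed

lemma kummer_sum_down_Suc: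
  "kummer_sum_down (Suc i) a b = kummer_sum_down i (a - 1) b + kummer_sum_down i a b"
proof -
  define f where "f r = Gamma (a / 2 - b - of_nat (Suc i) / 2 + of_nat r / 2 + 1/2) *
     rGamma (a / 2 - of_nat (Suc i) / 2 + of_nat r / 2 + 1/2)" for r
  have args: "a / 2 - b - of_nat (Suc i) / 2 + of_nat r / 2 + 1/2
          = (a - 1) / 2 - b - of_nat i / 2 + of_nat r / 2 + 1/2"
       "a / 2 - of_nat (Suc i) / 2 + of_nat r / 2 + 1/2 = (a - 1) / 2 - of_nat i / 2 + of_nat r / 2 + 1/2"
       "(a - 1) / 2 - b - of_nat i / 2 + of_nat (Suc r) / 2 + 1/2
          = a / 2 - b - of_nat i / 2 + of_nat r / 2 + 1/2"
       "(a - 1) / 2 - of_nat i / 2 + of_nat (Suc r) / 2 + 1/2 = a / 2 - of_nat i / 2 + of_nat r / 2 + 1/2"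
    for r
    by (simp_all add: field_simps)
  have "kummer_sum_down (Suc i) a b =
          (\<Sum>r\<le>i. of_nat (i choose r) * f r) + (\<Sum>r\<le>i. of_nat (i choose r) * f (Suc r))"
    unfolding kummer_sum_down_def f_def by (rule sum_binomial_Suc)
  then show ?thesis
    unfolding kummer_sum_down_def f_def args .
qed

text \<open>Inserts Gamma(w) / Gamma(w) with w = a/2 - b + 1/2, so that Kummer's value takes the
  shape of the general formula at i = 0, r = 0. The condition on a - 2b keeps w away from the
  poles.\<close>

lemma kummer_gamma_generic:
  assumes "kummer_generic a b"
  shows "kummer_gamma a b = 2 powr (- a) * Gamma (1/2) * Gamma (1 + a - b) *
     rGamma (a / 2 - b + 1/2) * rGamma (a / 2 - b + 1) *
     (Gamma (a / 2 - b + 1/2) * rGamma (a / 2 + 1/2))"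
proof -
  have "a / 2 - b + 1/2 \<notin> \<int>"
  proof
    assume "a / 2 - b + 1/2 \<in> \<int>"
    then have "2 * (a / 2 - b + 1/2) \<in> \<int>" by (rule Ints_mult[OF Ints_numeral])
    then show False
      using assms not_Int_shift[of "a - 2 * b" "2 * (a / 2 - b + 1/2)"]
      by (auto simp: kummer_generic_def algebra_simps)
  qed
  then have "Gamma (a / 2 - b + 1/2) * rGamma (a / 2 - b + 1/2) = 1"
    by (simp add: Gamma_times_rGamma not_Int_not_nonpos)
  then have "kummer_gamma a b =
     kummer_gamma a b * (Gamma (a / 2 - b + 1/2) * rGamma (a / 2 - b + 1/2))"
    by simp
  then show ?thesis
    unfolding kummer_gamma_def by (simp only: mult_ac)
qed

text \<open>In \<open>contiguous_down\<close> both series on the right have excess i when the one on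
  the left has excess i + 1. Each of the three terms carries a factor 2: the explicit one, the one
  from 2 powr (-(a-1)), and the one in c - b = 2z, whose z turns 1/Gamma(z+1) into 1/Gamma(z). What
  is left is the recurrence of \<open>kummer_sum_up\<close>. Division by b - 1 at each step builds
  up \<open>Gamma_shift_ratio b i\<close>.\<close>

lemma kummer_up:
  assumes "kummer_generic a b"
  shows "hyp_neg1 a b (1 + a - b + of_nat i) =
           2 powr (- a) * Gamma (1/2) * Gamma (1 + a - b + of_nat i) * Gamma_shift_ratio b i *
           rGamma (a / 2 - b + of_nat i / 2 + 1/2) * rGamma (a / 2 - b + of_nat i / 2 + 1) *
           kummer_sum_up i a b"
  using assms
proof (induction i arbitrary: a b)
  case 0
  then show ?case
    by (simp add: kummer kummer_gamma_generic kummer_sum_up_def Gamma_shift_ratio_def)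
next
  case (Suc i)
  define c z where "c = 2 + a - b + of_nat i" and "z = a / 2 - b + of_nat i / 2 + 1"
  note gen = kummer_generic_down[OF Suc.prems]
  have ab: "a - b \<notin> \<int>" "a \<in> \<int>\<^sub>\<le>\<^sub>0 \<or> b \<in> \<int>\<^sub>\<le>\<^sub>0"
    using Suc.prems by (auto simp: kummer_generic_def)
  have c: "c \<notin> \<int>" "c - 1 \<notin> \<int>"
    using not_Int_shift[OF ab(1), of c] not_Int_shift[OF ab(1), of "c - 1"]
    by (auto simp: c_def algebra_simps)
  \<comment> \<open>If b were 1, the series would have to terminate through a, and a - b would be an
    integer.\<close>
  have b: "b - 1 \<noteq> 0"
    using ab by (auto elim: nonpos_Ints_cases)
  have args: "1 + (a - 1) - (b - 1) + of_nat i = c - 1" "1 + a - (b - 1) + of_nat i = c"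
     "1 + a - b + of_nat (Suc i) = c"
     "(a - 1) / 2 - (b - 1) + of_nat i / 2 + 1/2 = z"
     "(a - 1) / 2 - (b - 1) + of_nat i / 2 + 1 = z + 1/2"
     "a / 2 - (b - 1) + of_nat i / 2 + 1/2 = z + 1/2"
     "a / 2 - (b - 1) + of_nat i / 2 + 1 = z + 1"
     "a / 2 - b + of_nat (Suc i) / 2 + 1/2 = z"
     "a / 2 - b + of_nat (Suc i) / 2 + 1 = z + 1/2"
    by (simp_all add: c_def z_def field_simps)
  have Gc: "Gamma c = (c - 1) * Gamma (c - 1)"
    using Gamma_plus1[of "c - 1"] c by (simp add: not_Int_not_nonpos)
  have rGz: "rGamma z = z * rGamma (z + 1)"
    by (simp add: rGamma_plus1)
  have shift: "Gamma_shift_ratio b (Suc i) = Gamma_shift_ratio (b - 1) i / (b - 1)"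
    by (simp add: Gamma_shift_ratio_def pochhammer_Suc diff_diff_eq)
  have pow: "2 powr (- (a - 1)) = 2 * 2 powr (- a)"
    using powr_add[of "2::complex" "- a" 1] by simp
  have cb: "c - b = 2 * z"
    by (simp add: c_def z_def field_simps)
  note IH = Suc.IH[OF gen(1)] Suc.IH[OF gen(2)]
  define X where "X = 2 powr (- a) * Gamma (1/2) * Gamma c * Gamma_shift_ratio (b - 1) i *
           rGamma z * rGamma (z + 1/2) * kummer_sum_up (Suc i) a b"
  have "2 * (b - 1) * hyp_neg1 a b c =
           (c - 1) * hyp_neg1 (a - 1) (b - 1) (c - 1) - (c - b) * hyp_neg1 a (b - 1) c"
    using ab gen c(1) by (intro contiguous_down) (auto simp: kummer_generic_def)
  also have "\<dots> = 2 * X"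
  proof -
    have "(c - 1) * (2 * w * g * G * s * (z * R) * Q * S1) -
            2 * z * (w * g * ((c - 1) * G) * s * Q * R * S2) =
          2 * (w * g * ((c - 1) * G) * s * (z * R) * Q * (S1 - S2))"
      for w g G s R Q S1 S2 :: complex
      by (simp add: algebra_simps)
    then show ?thesis
      unfolding X_def IH[unfolded args] cb kummer_sum_up_Suc rGz Gc pow .
  qed
  finally have "2 * ((b - 1) * hyp_neg1 a b c) = 2 * X"
    by (simp only: mult.assoc)
  then have "(b - 1) * hyp_neg1 a b c = X"
    by simp
  then have "hyp_neg1 a b c = X / (b - 1)"
    using b by (simp add: eq_divide_eq mult.commute)
  then show ?case
    unfolding args shift X_def by simp
qed

text \<open>The same bookkeeping with \<open>contiguous_up\<close>, which leaves b unchanged and has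
  coefficient 2 on the left; so no quotient of shifted Gamma functions of b accumulates.\<close>

lemma kummer_down:
  assumes "kummer_generic a b"
  shows "hyp_neg1 a b (1 + a - b - of_nat i) =
           2 powr (- a) * Gamma (1/2) * Gamma (1 + a - b - of_nat i) *
           rGamma (a / 2 - b - of_nat i / 2 + 1/2) * rGamma (a / 2 - b - of_nat i / 2 + 1) *
           kummer_sum_down i a b"
  using assms
proof (induction i arbitrary: a b)
  case 0
  then show ?case
    by (simp add: kummer kummer_gamma_generic kummer_sum_down_def)
next
  case (Suc i)
  define c z where "c = a - b - of_nat i" and "z = a / 2 - b - of_nat i / 2"
  note gen = kummer_generic_down[OF Suc.prems]
  have ab: "a - b \<notin> \<int>" "a \<in> \<int>\<^sub>\<le>\<^sub>0 \<or> b \<in> \<int>\<^sub>\<le>\<^sub>0"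
    using Suc.prems by (auto simp: kummer_generic_def)
  have c: "c \<notin> \<int>"
    using not_Int_shift[OF ab(1), of c] by (auto simp: c_def algebra_simps)
  then have "c \<noteq> 0" by auto
  have args: "1 + (a - 1) - b - of_nat i = c" "1 + a - b - of_nat i = c + 1"
     "1 + a - b - of_nat (Suc i) = c"
     "(a - 1) / 2 - b - of_nat i / 2 + 1/2 = z"
     "(a - 1) / 2 - b - of_nat i / 2 + 1 = z + 1/2"
     "a / 2 - b - of_nat i / 2 + 1/2 = z + 1/2"
     "a / 2 - b - of_nat i / 2 + 1 = z + 1"
     "a / 2 - b - of_nat (Suc i) / 2 + 1/2 = z"
     "a / 2 - b - of_nat (Suc i) / 2 + 1 = z + 1/2"
    by (simp_all add: c_def z_def field_simps)
  have Gc: "Gamma (c + 1) = c * Gamma c"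
    using Gamma_plus1[of c] c by (simp add: not_Int_not_nonpos)
  have rGz: "rGamma z = z * rGamma (z + 1)"
    by (simp add: rGamma_plus1)
  have pow: "2 powr (- (a - 1)) = 2 * 2 powr (- a)"
    using powr_add[of "2::complex" "- a" 1] by simp
  have cb: "c - b = 2 * z"
    by (simp add: c_def z_def field_simps)
  note IH = Suc.IH[OF gen(3)] Suc.IH[OF Suc.prems]
  have "2 * hyp_neg1 a b c = hyp_neg1 (a - 1) b c + (c - b) / c * hyp_neg1 a b (c + 1)"
    using ab gen c by (intro contiguous_up) (auto simp: kummer_generic_def)
  also have "(c - b) / c * hyp_neg1 a b (c + 1) = 2 * z * (2 powr (- a) * Gamma (1/2) * Gamma c *
          rGamma (z + 1/2) * rGamma (z + 1) * kummer_sum_down i a b)"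
    unfolding IH[unfolded args] cb Gc using \<open>c \<noteq> 0\<close> by simp
  also have "hyp_neg1 (a - 1) b c + 2 * z * (2 powr (- a) * Gamma (1/2) * Gamma c *
          rGamma (z + 1/2) * rGamma (z + 1) * kummer_sum_down i a b) =
        2 * (2 powr (- a) * Gamma (1/2) * Gamma c * rGamma z * rGamma (z + 1/2) *
           kummer_sum_down (Suc i) a b)"
    unfolding IH[unfolded args] kummer_sum_down_Suc rGz pow by (simp add: algebra_simps)
  finally show ?case
    unfolding args by simp
qed

subsection \<open>Coefficients and limiting values\<close>

text \<open>Kept as a finite sum of reciprocals of Pochhammer symbols, with k in the role of n,
  because continuity in the parameters is then immediate.\<close>

definition double_coeff :: "nat \<Rightarrow> complex \<Rightarrow> complex \<Rightarrow> complex" where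
  "double_coeff m \<rho> \<sigma> =
     (\<Sum>k\<le>m. (-1) ^ k / (pochhammer \<rho> (m - k) * pochhammer \<sigma> k * fact (m - k) * fact k))"

text \<open>Reversal of Pochhammer symbols: (rho)_m = (rho)_(m-k) (rho+m-k)_k with (rho+m-k)_k =
  (-1)^k (1-rho-m)_k, and likewise for the factorials. The two reversal signs cancel, so the
  alternating sign becomes the argument -1.\<close>

lemma double_coeff_eq_hyp_neg1:
  assumes "\<rho> \<notin> \<int>\<^sub>\<le>\<^sub>0"
  shows "double_coeff m \<rho> \<sigma> =
           1 / (pochhammer \<rho> m * fact m) * hyp_neg1 (- of_nat m) (1 - \<rho> - of_nat m) \<sigma>"
proof -
  have term_eq: "(-1) ^ k / (pochhammer \<rho> (m - k) * pochhammer \<sigma> k * fact (m - k) * fact k) =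
          1 / (pochhammer \<rho> m * fact m) * (hyp_term (- of_nat m) (1 - \<rho> - of_nat m) \<sigma> k * (-1) ^ k)"
    if "k \<le> m" for k
  proof -
    define R where "R = pochhammer (\<rho> + of_nat (m - k)) k"
    define S where "S = pochhammer (1 + of_nat (m - k) :: complex) k"
    have R: "pochhammer \<rho> m = pochhammer \<rho> (m - k) * R"
      using pochhammer_product[of "m - k" m \<rho>] that by (simp add: R_def)
    have S: "fact m = fact (m - k) * S"
      using pochhammer_product[of "m - k" m "1 :: complex"] that
      by (simp add: S_def pochhammer_fact)
    have R': "pochhammer (1 - \<rho> - of_nat m) k = (-1) ^ k * R"
      using pochhammer_minus[of "\<rho> + of_nat m - 1" k] that
      by (simp add: R_def of_nat_diff algebra_simps)
    have S': "pochhammer (- of_nat m) k = (-1) ^ k * S"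
      using pochhammer_minus[of "of_nat m :: complex" k] that
      by (simp add: S_def of_nat_diff algebra_simps)
    have "R \<noteq> 0" "S \<noteq> 0"
      using R pochhammer_neq_0[OF assms, of m] S by auto
    then show ?thesis
      unfolding hyp_term_def R S R' S' by (simp add: mult_ac)
  qed
  have "hyp_neg1 (- of_nat m) (1 - \<rho> - of_nat m) \<sigma> =
          (\<Sum>k\<le>m. hyp_term (- of_nat m) (1 - \<rho> - of_nat m) \<sigma> k * (-1) ^ k)"
    unfolding hyp_neg1_def
    by (rule suminf_finite) (auto simp: hyp_term_def pochhammer_of_nat_eq_0_iff)
  then show ?thesis
    unfolding double_coeff_def by (simp add: term_eq sum_distrib_left)
qed

section \<open>Continuity in rho and passage to exceptional values\<close>

lemma isCont_pochhammer:
  fixes f :: "complex \<Rightarrow> complex"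
  assumes "isCont f z"
  shows "isCont (\<lambda>z. pochhammer (f z) n) z"
  unfolding pochhammer_prod using assms by (intro continuous_intros)

lemma isCont_double_coeff:
  assumes "\<rho> \<notin> \<int>\<^sub>\<le>\<^sub>0" "\<sigma> \<rho> \<notin> \<int>\<^sub>\<le>\<^sub>0" "isCont \<sigma> \<rho>"
  shows "isCont (\<lambda>\<tau>. double_coeff m \<tau> (\<sigma> \<tau>)) \<rho>"
  unfolding double_coeff_def using assms
  by (intro continuous_intros isCont_pochhammer) (simp_all add: pochhammer_neq_0)

lemma eventually_at_double_not_Int:
  fixes \<rho> :: complex
  shows "eventually (\<lambda>\<tau>. 2 * \<tau> \<notin> \<int>) (at \<rho>)"
proof (cases "2 * \<rho> \<in> \<int>")
  case True
  \<comment> \<open>Distinct half-integers are at least 1/2 apart.\<close>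
  have "2 * \<tau> \<notin> \<int>" if "\<tau> \<noteq> \<rho>" "dist \<tau> \<rho> < 1/2" for \<tau>
  proof
    assume "2 * \<tau> \<in> \<int>"
    then have "2 * \<tau> - 2 * \<rho> \<in> \<int>" using True by (rule Ints_diff)
    then obtain n where n: "2 * \<tau> - 2 * \<rho> = of_int n" by (auto elim: Ints_cases)
    with that(1) have "n \<noteq> 0" by auto
    then have "1 \<le> norm (of_int n :: complex)" by (simp add: norm_of_int)
    also have "of_int n = 2 * (\<tau> - \<rho>)" using n by (simp add: algebra_simps)
    also have "norm \<dots> < 1"
      unfolding norm_mult using that(2) by (simp add: dist_norm)
    finally show False by simp
  qed
  then show ?thesis
    unfolding eventually_at by (intro exI[of _ "1/2"]) auto
next
  case False
  have "((\<lambda>\<tau>. 2 * \<tau>) \<longlongrightarrow> 2 * \<rho>) (at \<rho>)"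
    by (intro tendsto_intros)
  from topological_tendstoD[OF this, of "- \<int>"] False show ?thesis
    by (simp add: open_Compl)
qed

text \<open>\<open>F\<close> agrees with the continuous \<open>C\<close> on a punctured
  neighbourhood, so it tends to \<open>C \<rho>\<close> whatever its own value at the point is.
  Where \<open>P\<close> holds, this limit is the limiting value; elsewhere continuity of
  \<open>F\<close> and uniqueness of limits identify \<open>F \<rho>\<close>.\<close>

lemma limiting_valueI:
  assumes C: "isCont C \<rho>"
    and eq: "\<And>\<tau>. 2 * \<tau> \<notin> \<int> \<Longrightarrow> F \<tau> = C \<tau>"
    and F: "\<not> P \<rho> \<Longrightarrow> isCont F \<rho>"
  shows "has_limiting_value P F \<rho>" "limiting_value P F \<rho> = C \<rho>"
proof -
  have "eventually (\<lambda>\<tau>. C \<tau> = F \<tau>) (at \<rho>)"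
    using eventually_at_double_not_Int[of \<rho>] by eventually_elim (simp add: eq)
  then have lim: "(F \<longlongrightarrow> C \<rho>) (at \<rho>)"
    by (rule Lim_transform_eventually[OF C[unfolded isCont_def]])
  then show "has_limiting_value P F \<rho>"
    by (auto simp: has_limiting_value_def)
  have "F \<rho> = C \<rho>" if "\<not> P \<rho>"
    using F[OF that] lim unfolding isCont_def by (rule LIM_unique)
  then show "limiting_value P F \<rho> = C \<rho>"
    using lim by (auto simp: limiting_value_def intro: tendsto_Lim)
qed

section \<open>Absolute convergence and rearrangement of the double series\<close>

lemma summable_inverse_pochhammer_fact:
  fixes \<rho> x :: complex
  assumes "\<rho> \<notin> \<int>\<^sub>\<le>\<^sub>0"
  shows "summable (\<lambda>n. norm (x ^ n / (pochhammer \<rho> n * fact n)))"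
proof -
  \<comment> \<open>For n >= N both |rho + n| >= 1 and n >= 2|x| hold, so the quotient |x| / (|rho +
    n| (n + 1)) of consecutive terms is at most 1/2.\<close>
  define N where "N = nat \<lceil>norm \<rho> + 1 + 2 * norm x\<rceil>"
  have ratio: "norm (norm (x ^ Suc n / (pochhammer \<rho> (Suc n) * fact (Suc n))))
          \<le> 1/2 * norm (norm (x ^ n / (pochhammer \<rho> n * fact n)))" if "N \<le> n" for n
  proof -
    have n: "norm \<rho> + 1 + 2 * norm x \<le> real n"
      using that unfolding N_def by linarith
    have "real n = norm ((\<rho> + of_nat n) - \<rho>)" by simp
    also have "\<dots> \<le> norm (\<rho> + of_nat n) + norm \<rho>" by (rule norm_triangle_ineq4)
    finally have 1: "1 \<le> norm (\<rho> + of_nat n)" using n norm_ge_zero[of x] by linarith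
    have 2: "2 * norm x \<le> (real n + 1) * 1"
      using n norm_ge_zero[of \<rho>] unfolding mult_1_right by linarith
    also have "\<dots> \<le> (real n + 1) * norm (\<rho> + of_nat n)"
      using 1 by (intro mult_left_mono) auto
    finally have 3: "2 * norm x \<le> norm (\<rho> + of_nat n) * (real n + 1)"
      by (simp only: mult.commute)
    have "norm (x ^ Suc n / (pochhammer \<rho> (Suc n) * fact (Suc n))) =
        norm x / (norm (\<rho> + of_nat n) * (real n + 1)) * norm (x ^ n / (pochhammer \<rho> n * fact n))"
      using norm_of_nat[of "Suc n", where 'a = complex]
      by (simp add: pochhammer_Suc norm_mult norm_divide norm_power mult_ac add_ac)
    also have "\<dots> \<le> 1/2 * norm (x ^ n / (pochhammer \<rho> n * fact n))"
    proof (rule mult_right_mono)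
      have "0 < norm (\<rho> + of_nat n) * (real n + 1)"
        using 1 by (intro mult_pos_pos) auto
      then show "norm x / (norm (\<rho> + of_nat n) * (real n + 1)) \<le> 1/2"
        using 3 by (simp add: pos_divide_le_eq)
    qed simp
    finally show ?thesis by simp
  qed
  show ?thesis
    by (rule summable_ratio_test[of "1/2" N]) (simp, erule ratio)
qed

text \<open>Boundedness of \<open>\<Delta>\<close> gives the product majorant
  \<open>B * g m * h n\<close>, so the family is absolutely summable over all pairs. Summing it by
  rows gives the iterated series, summing it by antidiagonals gives \<open>s\<close>.\<close>

lemma double_series_eqI:
  assumes \<Delta>: "bounded (range \<Delta>)" and \<rho>: "\<rho> \<notin> \<int>\<^sub>\<le>\<^sub>0" and \<sigma>: "\<sigma> \<notin> \<int>\<^sub>\<le>\<^sub>0"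
    and s: "\<And>m. s m = \<Delta> m * x ^ m * double_coeff m \<rho> \<sigma>"
  shows "double_series_eq (double_term \<Delta> x \<rho> \<sigma>) s"
proof -
  define f where "f = (\<lambda>(m, n). double_term \<Delta> x \<rho> \<sigma> m n)"
  define g where "g n = norm (x ^ n / (pochhammer \<rho> n * fact n))" for n
  define h where "h n = norm (x ^ n / (pochhammer \<sigma> n * fact n))" for n
  obtain B where B: "\<And>n. norm (\<Delta> n) \<le> B"
    using \<Delta> by (auto simp: bounded_iff)
  have g_sum: "(g has_sum suminf g) UNIV"
  proof (rule norm_summable_imp_has_sum)
    show "summable (\<lambda>n. norm (g n))"
      using summable_inverse_pochhammer_fact[OF \<rho>] by (simp add: g_def)
    then show "g sums suminf g"
      by (rule summable_sums[OF summable_norm_cancel])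
  qed
  have h_sum: "(h has_sum suminf h) UNIV"
  proof (rule norm_summable_imp_has_sum)
    show "summable (\<lambda>n. norm (h n))"
      using summable_inverse_pochhammer_fact[OF \<sigma>] by (simp add: h_def)
    then show "h sums suminf h"
      by (rule summable_sums[OF summable_norm_cancel])
  qed
  have "(\<lambda>(m, n). B * g m * h n) summable_on (UNIV \<times> UNIV)"
  proof (rule summable_on_SigmaI)
    show "((\<lambda>n. case (m, n) of (m, n) \<Rightarrow> B * g m * h n) has_sum B * g m * suminf h) UNIV" for m
      using has_sum_cmult_right[OF h_sum] by simp
    show "(\<lambda>m. B * g m * suminf h) summable_on UNIV"
      using has_sum_cmult_left[OF has_sum_cmult_right[OF g_sum]] unfolding summable_on_def by blast
    show "0 \<le> (case (m, n) of (m, n) \<Rightarrow> B * g m * h n)" for m n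
      using order_trans[OF norm_ge_zero B] by (simp add: g_def h_def)
  qed
  then have "(\<lambda>p. norm (f p)) summable_on (UNIV \<times> UNIV)"
  proof (rule Infinite_Sum.abs_summable_on_comparison_test')
    fix p :: "nat \<times> nat"
    obtain m n where p: "p = (m, n)" by (cases p)
    have "norm (f p) = norm (\<Delta> (m + n)) * (g m * h n)"
      by (simp add: f_def p double_term_def g_def h_def norm_mult norm_divide norm_power power_add)
    also have "\<dots> \<le> B * (g m * h n)"
      using B by (intro mult_right_mono) (auto simp: g_def h_def)
    finally show "norm (f p) \<le> (case p of (m, n) \<Rightarrow> B * g m * h n)"
      by (simp add: p mult.assoc)
  qed
  then have f_summable: "f summable_on (UNIV \<times> UNIV)"
    by (rule abs_summable_summable)
  then obtain S where S: "(f has_sum S) (UNIV \<times> UNIV)"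
    by (auto simp: summable_on_def)
  have rows: "((\<lambda>n. f (m, n)) has_sum (\<Sum>n. double_term \<Delta> x \<rho> \<sigma> m n)) UNIV"
    and row_summable: "summable (\<lambda>n. double_term \<Delta> x \<rho> \<sigma> m n)" for m
  proof -
    have "(\<lambda>n. double_term \<Delta> x \<rho> \<sigma> m n) summable_on UNIV"
      using f_summable unfolding f_def by (rule summable_on_SigmaD1) simp
    then obtain b where b: "((\<lambda>n. double_term \<Delta> x \<rho> \<sigma> m n) has_sum b) UNIV"
      by (auto simp: summable_on_def)
    from has_sum_imp_sums[OF this] have "(\<lambda>n. double_term \<Delta> x \<rho> \<sigma> m n) sums b" .
    with b show "((\<lambda>n. f (m, n)) has_sum (\<Sum>n. double_term \<Delta> x \<rho> \<sigma> m n)) UNIV"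
      "summable (\<lambda>n. double_term \<Delta> x \<rho> \<sigma> m n)"
      by (auto simp: f_def sums_iff)
  qed
  have lhs: "(\<lambda>m. \<Sum>n. double_term \<Delta> x \<rho> \<sigma> m n) sums S"
    using has_sum_SigmaD[OF S rows] by (rule has_sum_imp_sums)
  \<comment> \<open>The bijection (m, n) -> (m + n, n) maps the quadrant onto the pairs with k <= m;
    truncated subtraction is exact there.\<close>
  have "((\<lambda>(m, k). f (m - k, k)) has_sum S) (SIGMA m:UNIV. {..m})"
    by (rule iffD2[OF has_sum_reindex_bij_witness S,
          where i1 = "\<lambda>(m, n). (m + n, n)" and j1 = "\<lambda>(m, k). (m - k, k)"]) auto
  moreover have "((\<lambda>k. case (m, k) of (m, k) \<Rightarrow> f (m - k, k)) has_sum s m) {..m}" for m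
  proof -
    have "s m = (\<Sum>k\<le>m. f (m - k, k))"
      unfolding s double_coeff_def sum_distrib_left
      by (intro sum.cong) (auto simp: f_def double_term_def mult_ac)
    then show ?thesis
      using has_sum_finite[of "{..m}" "\<lambda>k. f (m - k, k)"] by simp
  qed
  ultimately have "(s has_sum S) UNIV"
    by (rule has_sum_SigmaD)
  then have "s sums S"
    by (rule has_sum_imp_sums)
  with lhs row_summable show ?thesis
    by (auto simp: double_series_eq_def sums_iff)
qed

section \<open>Identification of the four right-hand sides\<close>

lemma not_half_Int_imp_not_nonpos_Int: "2 * \<rho> \<notin> \<int> \<Longrightarrow> (\<rho> :: complex) \<notin> \<int>\<^sub>\<le>\<^sub>0"
  by (metis Ints_mult Ints_numeral not_Int_not_nonpos)

lemma kummer_generic_not_half_Int: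
  assumes "2 * \<rho> \<notin> \<int>"
  shows "kummer_generic (- of_nat m) (1 - \<rho> - of_nat m)"
    and "kummer_generic (1 - \<rho> - of_nat m) (- of_nat m)"
proof -
  have \<rho>: "\<rho> \<notin> \<int>"
    using assms Ints_mult[OF Ints_numeral, of \<rho>] by blast
  then have \<rho>': "- \<rho> \<notin> \<int>"
    by simp
  show "kummer_generic (- of_nat m) (1 - \<rho> - of_nat m)"
    using not_Int_shift[OF \<rho>, of "- of_nat m - (1 - \<rho> - of_nat m)"]
      not_Int_shift[OF assms, of "- of_nat m - 2 * (1 - \<rho> - of_nat m)"]
    by (simp add: kummer_generic_def algebra_simps)
  show "kummer_generic (1 - \<rho> - of_nat m) (- of_nat m)"
    using not_Int_shift[OF \<rho>', of "1 - \<rho> - of_nat m - (- of_nat m)"]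
      not_Int_shift[OF \<rho>', of "1 - \<rho> - of_nat m - 2 * (- of_nat m)"]
    by (simp add: kummer_generic_def algebra_simps)
qed

text \<open>The dictionary is a = -m, b = 1 - rho - m, where the series terminates through a and 2
  powr (-a) is the factor 2^m.\<close>

lemma rhs1_generic:
  assumes "2 * \<rho> \<notin> \<int>"
  shows "rhs1 i m \<rho> = double_coeff m \<rho> (\<rho> + of_nat i)"
proof -
  define a b where "a = (- of_nat m :: complex)" and "b = 1 - \<rho> - of_nat m"
  note \<rho> = not_half_Int_imp_not_nonpos_Int[OF assms]
  have args: "\<rho> + of_nat i = 1 + a - b + of_nat i"
    "\<rho> + of_nat i / 2 + of_nat m / 2 - 1/2 = a / 2 - b + of_nat i / 2 + 1/2"
    "\<rho> + of_nat i / 2 + of_nat m / 2 = a / 2 - b + of_nat i / 2 + 1"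
    "\<rho> + of_nat m / 2 + of_nat i / 2 + of_nat r / 2 - 1/2 = a / 2 - b + of_nat i / 2 + of_nat r / 2 + 1/2"
    "of_nat r / 2 - of_nat i / 2 - of_nat m / 2 + 1/2 = a / 2 - of_nat i / 2 + of_nat r / 2 + 1/2"
    for r
    by (simp_all add: a_def b_def field_simps)
  have pow: "(2::complex) ^ m = 2 powr (- a)"
    by (simp add: a_def powr_nat')
  show ?thesis
    unfolding double_coeff_eq_hyp_neg1[OF \<rho>] a_def[symmetric] b_def[symmetric]
    unfolding args(1) kummer_up[OF kummer_generic_not_half_Int(1)[OF assms], of m, folded a_def b_def]
    unfolding rhs1_def args(2) unfolding args(3-) unfolding b_def[symmetric] args(1) kummer_sum_up_def pow
    by (simp add: mult_ac)
qed

lemma rhs2_generic: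
  assumes "2 * \<rho> \<notin> \<int>"
  shows "rhs2 i m \<rho> = double_coeff m \<rho> (\<rho> - of_nat i)"
proof -
  define a b where "a = (- of_nat m :: complex)" and "b = 1 - \<rho> - of_nat m"
  note \<rho> = not_half_Int_imp_not_nonpos_Int[OF assms]
  have args: "\<rho> - of_nat i = 1 + a - b - of_nat i"
    "\<rho> - of_nat i / 2 + of_nat m / 2 - 1/2 = a / 2 - b - of_nat i / 2 + 1/2"
    "\<rho> - of_nat i / 2 + of_nat m / 2 = a / 2 - b - of_nat i / 2 + 1"
    "\<rho> + of_nat m / 2 - of_nat i / 2 + of_nat r / 2 - 1/2 = a / 2 - b - of_nat i / 2 + of_nat r / 2 + 1/2"
    "of_nat r / 2 - of_nat i / 2 - of_nat m / 2 + 1/2 = a / 2 - of_nat i / 2 + of_nat r / 2 + 1/2"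
    for r
    by (simp_all add: a_def b_def field_simps)
  have pow: "(2::complex) ^ m = 2 powr (- a)"
    by (simp add: a_def powr_nat')
  show ?thesis
    unfolding double_coeff_eq_hyp_neg1[OF \<rho>] a_def[symmetric] b_def[symmetric]
    unfolding args(1) kummer_down[OF kummer_generic_not_half_Int(1)[OF assms], of m, folded a_def b_def]
    unfolding rhs2_def args(2) unfolding args(3-) unfolding args(1) kummer_sum_down_def pow
    by (simp add: mult_ac)
qed

text \<open>The roles are swapped: now b = -m terminates the series, 1 + a - b = 2 - rho, and 2 powr
  (-a) is the complex power with exponent rho - 1 + m. The symmetry of the series in its upper
  parameters permits this reading.\<close>

lemma rhs3_generic:
  assumes "2 * \<rho> \<notin> \<int>"
  shows "rhs3 i m \<rho> = double_coeff m \<rho> (2 - \<rho> + of_nat i)"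
proof -
  define a b where "a = 1 - \<rho> - of_nat m" and "b = (- of_nat m :: complex)"
  note \<rho> = not_half_Int_imp_not_nonpos_Int[OF assms]
  have args: "2 - \<rho> + of_nat i = 1 + a - b + of_nat i"
    "of_nat m / 2 - \<rho> / 2 + of_nat i / 2 + 1 = a / 2 - b + of_nat i / 2 + 1/2"
    "of_nat m / 2 - \<rho> / 2 + of_nat i / 2 + 3/2 = a / 2 - b + of_nat i / 2 + 1"
    "of_nat m / 2 - \<rho> / 2 + of_nat i / 2 + of_nat r / 2 + 1 = a / 2 - b + of_nat i / 2 + of_nat r / 2 + 1/2"
    "of_nat r / 2 - \<rho> / 2 - of_nat m / 2 - of_nat i / 2 + 1 = a / 2 - of_nat i / 2 + of_nat r / 2 + 1/2"
    "\<rho> - 1 + of_nat m = - a"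
    for r
    by (simp_all add: a_def b_def field_simps)
  show ?thesis
    unfolding double_coeff_eq_hyp_neg1[OF \<rho>] a_def[symmetric] b_def[symmetric] hyp_neg1_commute[of b]
    unfolding args(1) kummer_up[OF kummer_generic_not_half_Int(2)[OF assms], of m, folded a_def b_def]
    unfolding rhs3_def args unfolding b_def[symmetric] kummer_sum_up_def
    by (simp add: mult_ac)
qed

lemma rhs4_generic:
  assumes "2 * \<rho> \<notin> \<int>"
  shows "rhs4 i m \<rho> = double_coeff m \<rho> (2 - \<rho> - of_nat i)"
proof -
  define a b where "a = 1 - \<rho> - of_nat m" and "b = (- of_nat m :: complex)"
  note \<rho> = not_half_Int_imp_not_nonpos_Int[OF assms]
  have args: "2 - \<rho> - of_nat i = 1 + a - b - of_nat i"
    "of_nat m / 2 - \<rho> / 2 - of_nat i / 2 + 1 = a / 2 - b - of_nat i / 2 + 1/2"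
    "of_nat m / 2 - \<rho> / 2 - of_nat i / 2 + 3/2 = a / 2 - b - of_nat i / 2 + 1"
    "of_nat m / 2 - \<rho> / 2 - of_nat i / 2 + of_nat r / 2 + 1 = a / 2 - b - of_nat i / 2 + of_nat r / 2 + 1/2"
    "of_nat r / 2 - \<rho> / 2 - of_nat m / 2 - of_nat i / 2 + 1 = a / 2 - of_nat i / 2 + of_nat r / 2 + 1/2"
    "\<rho> - 1 + of_nat m = - a"
    for r
    by (simp_all add: a_def b_def field_simps)
  show ?thesis
    unfolding double_coeff_eq_hyp_neg1[OF \<rho>] a_def[symmetric] b_def[symmetric] hyp_neg1_commute[of b]
    unfolding args(1) kummer_down[OF kummer_generic_not_half_Int(2)[OF assms], of m, folded a_def b_def]
    unfolding rhs4_def args kummer_sum_down_def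
    by (simp add: mult_ac)
qed

lemma isCont_rhs1:
  assumes "\<rho> \<notin> \<int>\<^sub>\<le>\<^sub>0" "\<not> pole1 i m \<rho>"
  shows "isCont (rhs1 i m) \<rho>"
proof -
  \<comment> \<open>\<open>pole1\<close> does not cover the denominator of the shift ratio; its
    zeros in rho are all nonpositive integers, which the assumption on rho excludes.\<close>
  have "pochhammer (1 - \<rho> - of_nat m - of_nat i) i \<noteq> 0"
  proof
    assume "pochhammer (1 - \<rho> - of_nat m - of_nat i) i = 0"
    then obtain k where k: "k < i" "1 - \<rho> - of_nat m - of_nat i = - of_nat k"
      by (auto simp: pochhammer_eq_0_iff)
    then have "\<rho> = - of_nat (m + (i - Suc k))"
      by (simp add: of_nat_diff algebra_simps)
    with assms(1) show False
      using minus_of_nat_in_nonpos_Ints by blast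
  qed
  then show ?thesis
    using assms unfolding rhs1_def[abs_def] Gamma_shift_ratio_def pole1_def
    by (intro continuous_intros isCont_pochhammer) (auto simp: pochhammer_neq_0)
qed

lemma isCont_rhs2:
  assumes "\<rho> \<notin> \<int>\<^sub>\<le>\<^sub>0" "\<not> pole2 i m \<rho>"
  shows "isCont (rhs2 i m) \<rho>"
  using assms unfolding rhs2_def[abs_def] pole2_def
  by (intro continuous_intros isCont_pochhammer) (auto simp: pochhammer_neq_0)

lemma isCont_rhs3:
  assumes "\<rho> \<notin> \<int>\<^sub>\<le>\<^sub>0" "\<not> pole3 i m \<rho>"
  shows "isCont (rhs3 i m) \<rho>"
  using assms unfolding rhs3_def[abs_def] pole3_def
  by (intro continuous_intros isCont_pochhammer) (auto simp: pochhammer_neq_0)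

lemma isCont_rhs4:
  assumes "\<rho> \<notin> \<int>\<^sub>\<le>\<^sub>0" "\<not> pole4 i m \<rho>"
  shows "isCont (rhs4 i m) \<rho>"
  using assms unfolding rhs4_def[abs_def] pole4_def
  by (intro continuous_intros isCont_pochhammer) (auto simp: pochhammer_neq_0)

text \<open>The lower parameter is a function \<open>\<sigma>\<close> of rho because it has to move
  along with rho in the limit, with opposite sign in the last two identities.\<close>

lemma double_series_eq_limiting_value:
  assumes \<Delta>: "bounded (range \<Delta>)"
    and \<rho>: "\<rho> \<notin> \<int>\<^sub>\<le>\<^sub>0" and \<sigma>: "\<sigma> \<rho> \<notin> \<int>\<^sub>\<le>\<^sub>0" "isCont \<sigma> \<rho>"
    and generic: "\<And>m \<tau>. 2 * \<tau> \<notin> \<int> \<Longrightarrow> F m \<tau> = double_coeff m \<tau> (\<sigma> \<tau>)"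
    and cont: "\<And>m. \<not> P m \<rho> \<Longrightarrow> isCont (F m) \<rho>"
  shows "(\<forall>m. has_limiting_value (P m) (F m) \<rho>) \<and>
         double_series_eq (double_term \<Delta> x \<rho> (\<sigma> \<rho>)) (\<lambda>m. \<Delta> m * x ^ m * limiting_value (P m) (F m) \<rho>)"
proof -
  have lim: "has_limiting_value (P m) (F m) \<rho>"
    "limiting_value (P m) (F m) \<rho> = double_coeff m \<rho> (\<sigma> \<rho>)" for m
    using limiting_valueI[of \<rho> "\<lambda>\<tau>. double_coeff m \<tau> (\<sigma> \<tau>)" "F m" "P m"]
      isCont_double_coeff[OF \<rho> \<sigma>] generic cont by auto
  show ?thesis
    by (intro conjI allI lim(1) double_series_eqI \<Delta> \<rho> \<sigma>) (simp add: lim(2))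
qed

theorem theorem2p1:
  fixes \<Delta> :: "nat \<Rightarrow> complex" and i :: nat and x \<rho> :: complex
  assumes "bounded (range \<Delta>)"
    and "\<rho> \<notin> \<int>\<^sub>\<le>\<^sub>0"
  shows
    "(\<rho> + of_nat i \<notin> \<int>\<^sub>\<le>\<^sub>0 \<longrightarrow>
           (\<forall>m. has_limiting_value (pole1 i m) (rhs1 i m) \<rho>) \<and>
           double_series_eq (double_term \<Delta> x \<rho> (\<rho> + of_nat i))
             (\<lambda>m. \<Delta> m * x ^ m * limiting_value (pole1 i m) (rhs1 i m) \<rho>)) \<and>
     (\<rho> - of_nat i \<notin> \<int>\<^sub>\<le>\<^sub>0 \<longrightarrow>
           (\<forall>m. has_limiting_value (pole2 i m) (rhs2 i m) \<rho>) \<and>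
           double_series_eq (double_term \<Delta> x \<rho> (\<rho> - of_nat i))
             (\<lambda>m. \<Delta> m * x ^ m * limiting_value (pole2 i m) (rhs2 i m) \<rho>)) \<and>
     (2 - \<rho> + of_nat i \<notin> \<int>\<^sub>\<le>\<^sub>0 \<longrightarrow>
           (\<forall>m. has_limiting_value (pole3 i m) (rhs3 i m) \<rho>) \<and>
           double_series_eq (double_term \<Delta> x \<rho> (2 - \<rho> + of_nat i))
             (\<lambda>m. \<Delta> m * x ^ m * limiting_value (pole3 i m) (rhs3 i m) \<rho>)) \<and>
     (2 - \<rho> - of_nat i \<notin> \<int>\<^sub>\<le>\<^sub>0 \<longrightarrow>
           (\<forall>m. has_limiting_value (pole4 i m) (rhs4 i m) \<rho>) \<and>
           double_series_eq (double_term \<Delta> x \<rho> (2 - \<rho> - of_nat i))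
             (\<lambda>m. \<Delta> m * x ^ m * limiting_value (pole4 i m) (rhs4 i m) \<rho>))"
proof (intro conjI[of "_ \<longrightarrow> _"] impI)
  note main = double_series_eq_limiting_value[OF assms]
  show "(\<forall>m. has_limiting_value (pole1 i m) (rhs1 i m) \<rho>) \<and>
        double_series_eq (double_term \<Delta> x \<rho> (\<rho> + of_nat i))
          (\<lambda>m. \<Delta> m * x ^ m * limiting_value (pole1 i m) (rhs1 i m) \<rho>)"
    if "\<rho> + of_nat i \<notin> \<int>\<^sub>\<le>\<^sub>0"
    using main[where \<sigma> = "\<lambda>\<tau>. \<tau> + of_nat i", OF that _ rhs1_generic isCont_rhs1[OF assms(2)]]
    by simp
  show "(\<forall>m. has_limiting_value (pole2 i m) (rhs2 i m) \<rho>) \<and>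
        double_series_eq (double_term \<Delta> x \<rho> (\<rho> - of_nat i))
          (\<lambda>m. \<Delta> m * x ^ m * limiting_value (pole2 i m) (rhs2 i m) \<rho>)"
    if "\<rho> - of_nat i \<notin> \<int>\<^sub>\<le>\<^sub>0"
    using main[where \<sigma> = "\<lambda>\<tau>. \<tau> - of_nat i", OF that _ rhs2_generic isCont_rhs2[OF assms(2)]]
    by simp
  show "(\<forall>m. has_limiting_value (pole3 i m) (rhs3 i m) \<rho>) \<and>
        double_series_eq (double_term \<Delta> x \<rho> (2 - \<rho> + of_nat i))
          (\<lambda>m. \<Delta> m * x ^ m * limiting_value (pole3 i m) (rhs3 i m) \<rho>)"
    if "2 - \<rho> + of_nat i \<notin> \<int>\<^sub>\<le>\<^sub>0"
    using main[where \<sigma> = "\<lambda>\<tau>. 2 - \<tau> + of_nat i", OF that _ rhs3_generic isCont_rhs3[OF assms(2)]]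
    by simp
  show "(\<forall>m. has_limiting_value (pole4 i m) (rhs4 i m) \<rho>) \<and>
        double_series_eq (double_term \<Delta> x \<rho> (2 - \<rho> - of_nat i))
          (\<lambda>m. \<Delta> m * x ^ m * limiting_value (pole4 i m) (rhs4 i m) \<rho>)"
    if "2 - \<rho> - of_nat i \<notin> \<int>\<^sub>\<le>\<^sub>0"
    using main[where \<sigma> = "\<lambda>\<tau>. 2 - \<tau> - of_nat i", OF that _ rhs4_generic isCont_rhs4[OF assms(2)]]
    by simp
qed

end
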